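(* Let $G_n=\mathrm{Alt}(n)$ for all $n$, or $G_n=\mathrm{Sym}(n)$ for all $n$. Let $S_n\subseteq G_n$ be symmetric subsets and $\mathcal{G}_n=\mathrm{Cay}(G_n,S_n)$. Then, given $M_n\in\mathbb{N}$ satisfying $M_n=o(n)$ as $n\to\infty$ and functions $f_i^n:G_n\to\mathbb{R}$ for $i=1,\dots,M_n$, there exists an orthonormal basis $\mathcal{B}_n$ of $\ell^2(G_n)$ consisting of real-valued eigenfunctions of (the adjacency operator of) $\mathcal{G}_n$ such that for all $n$ sufficiently large, every $\varphi\in\mathcal{B}_n$ and every $i=1,\dots,M_n$, $$\left|\mu_\varphi[f_i^n]-\frac{\sum_{g\in G_n}f_i^n(g)}{|G_n|}\right|\le 192\,\frac{\log(n)}{\sqrt{n}}\,\frac{\|f_i^n\|_{\ell^2(G_n)}}{\sqrt{|G_n|}}.$$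
   Context: $\mathrm{Alt}(n)$ and $\mathrm{Sym}(n)$ are the alternating and symmetric groups on $n$ letters. For a finite group $G$, $\ell^2(G)$ is the space of complex-valued functions on $G$ with inner product $\langle f_1,f_2\rangle=\sum_{g\in G}f_1(g)\overline{f_2(g)}$ (counting measure) and associated norm. A subset $S\subseteq G$ is symmetric if $S=S^{-1}$. $\mathrm{Cay}(G,S)$ is the Cayley graph with vertex set $G$ and edges joining $g$ to $gs$ for $s\in S$; its adjacency operator on $\ell^2(G)$ is $\mathcal{A}[f](g)=\sum_{s\in S}f(gs)$. For $\varphi\in\ell^2(G)$ with $\|\varphi\|_{\ell^2}=1$, $\mu_\varphi[f]=\sum_{g\in G}f(g)|\varphi(g)|^2$. *)

theory Defs
  imports
    Complex_Main
    "HOL-Algebra.Sym_Groups"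
    "HOL-Library.Function_Algebras"
    "HOL-Library.Landau_Symbols"
begin

text \<open>
  A function on \<open>G\<close> is represented by the total function that agrees with it on \<open>carrier G\<close>
  and is \<open>0\<close> elsewhere, so that equality of functions on \<open>G\<close> is equality in HOL.
\<close>

definition ell2 :: "('a, 'm) monoid_scheme \<Rightarrow> ('a \<Rightarrow> complex) set" where
  "ell2 G = {f. \<forall>g. g \<notin> carrier G \<longrightarrow> f g = 0}"

definition ell2_inner ::
    "('a, 'm) monoid_scheme \<Rightarrow> ('a \<Rightarrow> complex) \<Rightarrow> ('a \<Rightarrow> complex) \<Rightarrow> complex" where
  "ell2_inner G f\<^sub>1 f\<^sub>2 = (\<Sum>g\<in>carrier G. f\<^sub>1 g * cnj (f\<^sub>2 g))"

definition ell2_norm :: "('a, 'm) monoid_scheme \<Rightarrow> ('a \<Rightarrow> complex) \<Rightarrow> real" where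
  "ell2_norm G f = sqrt (Re (ell2_inner G f f))"

definition fun_scale :: "complex \<Rightarrow> ('a \<Rightarrow> complex) \<Rightarrow> 'a \<Rightarrow> complex" where
  "fun_scale c f = (\<lambda>g. c * f g)"

lemma vector_space_fun_scale: "vector_space fun_scale"
  by unfold_locales (auto simp: fun_scale_def fun_eq_iff algebra_simps)

text \<open>
  The span is the algebraic one (finite linear combinations); for finite \<open>G\<close> this is the
  usual notion of an orthonormal basis.
\<close>

definition orthonormal_basis ::
    "('a, 'm) monoid_scheme \<Rightarrow> ('a \<Rightarrow> complex) set \<Rightarrow> bool" where
  "orthonormal_basis G B \<longleftrightarrow>
     B \<subseteq> ell2 G \<and>
     (\<forall>\<phi>\<in>B. \<forall>\<psi>\<in>B. ell2_inner G \<phi> \<psi> = (if \<phi> = \<psi> then 1 else 0)) \<and>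
     module.span fun_scale B = ell2 G"

definition cayley_adjacency ::
    "('a, 'm) monoid_scheme \<Rightarrow> 'a set \<Rightarrow> ('a \<Rightarrow> complex) \<Rightarrow> 'a \<Rightarrow> complex" where
  "cayley_adjacency G S f =
     (\<lambda>g. if g \<in> carrier G then \<Sum>s\<in>S. f (g \<otimes>\<^bsub>G\<^esub> s) else 0)"

definition cayley_eigenfunction ::
    "('a, 'm) monoid_scheme \<Rightarrow> 'a set \<Rightarrow> ('a \<Rightarrow> complex) \<Rightarrow> bool" where
  "cayley_eigenfunction G S \<phi> \<longleftrightarrow>
     \<phi> \<in> ell2 G \<and> \<phi> \<noteq> 0 \<and> (\<exists>c. cayley_adjacency G S \<phi> = fun_scale c \<phi>)"

definition mass :: "('a, 'm) monoid_scheme \<Rightarrow> ('a \<Rightarrow> complex) \<Rightarrow> ('a \<Rightarrow> real) \<Rightarrow> real" where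
  "mass G \<phi> f = (\<Sum>g\<in>carrier G. f g * (cmod (\<phi> g))\<^sup>2)"

end

theory Submission
  imports "HOL-Analysis.Function_Topology" "HOL-Analysis.Convex" Defs
begin

text \<open>
  The adjacency operator commutes with left translations, so its eigenspaces are left invariant.
  After splitting off the constant and the sign function, every nonzero left-invariant space of functions
  on \<open>Alt n\<close> or \<open>Sym n\<close> has dimension \<open>d \<ge> n div 4\<close>. On such a space the
  quadratic form \<open>\<phi> \<mapsto> \<mu>\<^sub>\<phi>[f] - mean f\<close> has trace \<open>0\<close> and squared Hilbert--Schmidt
  norm at most \<open>d \<parallel>f\<parallel>\<^sup>2 / |G|\<close>, because the diagonal of the kernel of the orthogonal
  projection is constant.

  Instead of a random orthonormal basis of the eigenspace, we take one that minimises
  \<open>\<Sum>\<^sub>i \<Sum>\<^sub>j exp (W\<^sub>i\<^sub>j\<^sub>j)\<close> over the compact orthogonal group, where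
  \<open>W\<^sub>i = (\<plusminus> sqrt d T\<^sub>i + T\<^sub>i\<^sup>2) / 16\<close> and the \<open>T\<^sub>i\<close> are the normalised quadratic forms.
  The second-order conditions for rotations in the coordinate planes, summed over all pairs of basis
  vectors, bound the potential and hence all diagonal entries of the \<open>T\<^sub>i\<close>
  by \<open>16 ln (M d) / sqrt d\<close>.
\<close>

section \<open>Orthonormal families of functions on a finite set\<close>

text \<open>Under a uniformly random rotation, the diagonal entries of a form with trace 0 and
  squared Hilbert-Schmidt norm at most \<open>d\<close> have standard deviation of order at most
  \<open>1 / sqrt d\<close>; hence the factor \<open>sqrt d\<close> in the exponent. The sum of
  exponentials takes over the role of a union bound: at a minimiser the total is so balanced that a
  large entry can only be paid for by the \<open>M * d\<close> pairs of a form and a basis vector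
  together, which bounds its exponential by \<open>M * d\<close> and the entry by a logarithm. The
  constant and sign functions have to be split off because a line admits no rotation. Nothing is
  lost there: their squares are constant on the group, so their deviation from the mean is exactly
  0. The growth condition on \<open>M\<close> is used only to ensure \<open>M \<le> d\<close>, which
  turns \<open>ln (M * d)\<close> into at most \<open>2 * ln d\<close>. Real functions suffice
  throughout, since a symmetric adjacency operator has real eigenvalues and a real orthonormal basis
  is also a complex one.\<close>

definition ip :: "'a set \<Rightarrow> ('a \<Rightarrow> real) \<Rightarrow> ('a \<Rightarrow> real) \<Rightarrow> real" where
  "ip X u v = (\<Sum>g\<in>X. u g * v g)"

definition orthonormal_family :: "'a set \<Rightarrow> nat \<Rightarrow> (nat \<Rightarrow> 'a \<Rightarrow> real) \<Rightarrow> bool" where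
  "orthonormal_family X d e \<longleftrightarrow> (\<forall>j<d. \<forall>k<d. ip X (e j) (e k) = of_bool (j = k))"

definition lin_subspace :: "('a \<Rightarrow> real) set \<Rightarrow> bool" where
  "lin_subspace E \<longleftrightarrow> (\<lambda>_. 0) \<in> E \<and> (\<forall>u\<in>E. \<forall>v\<in>E. (\<lambda>g. u g + v g) \<in> E) \<and>
     (\<forall>c. \<forall>u\<in>E. (\<lambda>g. c * u g) \<in> E)"

text \<open>The expansion is demanded only at points of \<open>X\<close>, because \<open>ip\<close>
  does not see values elsewhere. For spaces of functions vanishing outside \<open>X\<close> it holds
  everywhere.\<close>

definition onb_of :: "'a set \<Rightarrow> ('a \<Rightarrow> real) set \<Rightarrow> nat \<Rightarrow> (nat \<Rightarrow> 'a \<Rightarrow> real) \<Rightarrow> bool" where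
  "onb_of X E d e \<longleftrightarrow> orthonormal_family X d e \<and> (\<forall>j<d. e j \<in> E) \<and>
     (\<forall>v\<in>E. \<forall>g\<in>X. v g = (\<Sum>j<d. ip X v (e j) * e j g))"

lemma ip_commute: "ip X u v = ip X v u"
  by (simp add: ip_def mult.commute)

lemma ip_self_nonneg: "0 \<le> ip X u u"
  by (simp add: ip_def sum_nonneg)

lemma ip_self_eq_0_iff:
  assumes "finite X"
  shows "ip X u u = 0 \<longleftrightarrow> (\<forall>g\<in>X. u g = 0)"
  using assms by (simp add: ip_def sum_nonneg_eq_0_iff)

lemma ip_add_left: "ip X (\<lambda>g. u g + v g) w = ip X u w + ip X v w"
  by (simp add: ip_def sum.distrib algebra_simps)

lemma ip_diff_left: "ip X (\<lambda>g. u g - v g) w = ip X u w - ip X v w"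
  by (simp add: ip_def sum_subtractf algebra_simps)

lemma ip_scale_left: "ip X (\<lambda>g. c * u g) w = c * ip X u w"
  by (simp add: ip_def sum_distrib_left algebra_simps)

lemma ip_sum_left: "ip X (\<lambda>g. \<Sum>j\<in>J. c j * u j g) w = (\<Sum>j\<in>J. c j * ip X (u j) w)"
proof -
  have "ip X (\<lambda>g. \<Sum>j\<in>J. c j * u j g) w = (\<Sum>g\<in>X. \<Sum>j\<in>J. c j * (u j g * w g))"
    by (simp add: ip_def sum_distrib_right mult.assoc)
  also have "\<dots> = (\<Sum>j\<in>J. \<Sum>g\<in>X. c j * (u j g * w g))" by (rule sum.swap)
  finally show ?thesis by (simp add: ip_def sum_distrib_left)
qed

lemma ip_diff_right: "ip X w (\<lambda>g. u g - v g) = ip X w u - ip X w v"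
  by (metis ip_commute ip_diff_left)

lemma ip_scale_right: "ip X w (\<lambda>g. c * u g) = c * ip X w u"
  by (metis ip_commute ip_scale_left)

lemma ip_sum_right: "ip X w (\<lambda>g. \<Sum>j\<in>J. c j * u j g) = (\<Sum>j\<in>J. c j * ip X w (u j))"
  by (subst ip_commute, subst ip_sum_left) (simp add: ip_commute)

lemma ip_cong:
  assumes "\<And>g. g \<in> X \<Longrightarrow> u g = u' g" "\<And>g. g \<in> X \<Longrightarrow> v g = v' g"
  shows "ip X u v = ip X u' v'"
  using assms by (simp add: ip_def)

lemma orthonormal_familyD:
  assumes "orthonormal_family X d e" "j < d" "k < d"
  shows "ip X (e j) (e k) = of_bool (j = k)"
  using assms by (simp add: orthonormal_family_def)

lemma onb_of_expand:
  assumes "onb_of X E d e" "v \<in> E" "g \<in> X"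
  shows "v g = (\<Sum>j<d. ip X v (e j) * e j g)"
  using assms unfolding onb_of_def by blast

lemma orthonormal_coeff:
  assumes "orthonormal_family X d e" "k < d"
  shows "ip X (\<lambda>g. \<Sum>j<d. c j * e j g) (e k) = c k"
  using assms by (simp add: ip_sum_left orthonormal_familyD)

lemma orthonormal_combination:
  assumes "orthonormal_family X d e"
  shows "ip X (\<lambda>g. \<Sum>j<d. a j * e j g) (\<lambda>g. \<Sum>j<d. b j * e j g) = (\<Sum>j<d. a j * b j)"
  by (subst ip_sum_right) (simp add: orthonormal_coeff[OF assms] mult.commute)

lemma bessel:
  assumes "orthonormal_family X d e"
  shows "(\<Sum>j<d. (ip X v (e j))\<^sup>2) \<le> ip X v v"
proof -
  let ?p = "\<lambda>g. \<Sum>j<d. ip X v (e j) * e j g"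
  have "0 \<le> ip X (\<lambda>g. v g - ?p g) (\<lambda>g. v g - ?p g)" by (rule ip_self_nonneg)
  also have "\<dots> = ip X v v - ip X v ?p - ip X ?p v + ip X ?p ?p"
    by (simp add: ip_diff_left ip_diff_right)
  also have "ip X ?p v = ip X v ?p" by (rule ip_commute)
  also have "ip X v ?p = (\<Sum>j<d. (ip X v (e j))\<^sup>2)"
    by (simp add: ip_sum_right power2_eq_square)
  also have "ip X ?p ?p = (\<Sum>j<d. (ip X v (e j))\<^sup>2)"
    by (simp add: orthonormal_combination[OF assms] power2_eq_square)
  finally show ?thesis by simp
qed

lemma lin_subspace_add:
  assumes "lin_subspace E" "u \<in> E" "v \<in> E"
  shows "(\<lambda>g. u g + v g) \<in> E"
  using assms by (simp add: lin_subspace_def)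

lemma lin_subspace_scale:
  assumes "lin_subspace E" "u \<in> E"
  shows "(\<lambda>g. c * u g) \<in> E"
  using assms by (simp add: lin_subspace_def)

lemma lin_subspace_sum:
  assumes "lin_subspace E" "\<And>j. j \<in> J \<Longrightarrow> u j \<in> E"
  shows "(\<lambda>g. \<Sum>j\<in>J. c j * u j g) \<in> E"
  using assms(2)
proof (induction J rule: infinite_finite_induct)
  case (insert x F)
  have "(\<lambda>g. c x * u x g + (\<Sum>j\<in>F. c j * u j g)) \<in> E"
    using insert assms(1) by (auto simp: lin_subspace_def)
  then show ?case using insert by simp
qed (use assms in \<open>auto simp: lin_subspace_def\<close>)

lemma lin_subspace_diff:
  assumes "lin_subspace E" "u \<in> E" "v \<in> E"
  shows "(\<lambda>g. u g - v g) \<in> E"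
proof -
  have "(\<lambda>g. u g + (-1) * v g) \<in> E"
    using assms by (intro lin_subspace_add lin_subspace_scale)
  then show ?thesis by simp
qed

text \<open>Bessel's inequality for the indicator of a point bounds the diagonal of the projection
  kernel by 1 there; its sum over \<open>X\<close> is \<open>d\<close>.\<close>

lemma orthonormal_family_card_le:
  assumes "finite X" "orthonormal_family X d e"
  shows "d \<le> card X"
proof -
  have ind: "ip X (\<lambda>h. of_bool (h = g)) v = v g" if "g \<in> X" for g v
    using that assms(1) by (simp add: ip_def)
  have "real d = (\<Sum>j<d. ip X (e j) (e j))" using assms(2) by (simp add: orthonormal_familyD)
  also have "\<dots> = (\<Sum>g\<in>X. \<Sum>j<d. (e j g)\<^sup>2)"
    unfolding ip_def by (subst sum.swap) (simp add: power2_eq_square)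
  also have "\<dots> \<le> (\<Sum>g\<in>X. 1)"
  proof (rule sum_mono)
    fix g assume g: "g \<in> X"
    show "(\<Sum>j<d. (e j g)\<^sup>2) \<le> 1"
      using bessel[OF assms(2), of "\<lambda>h. of_bool (h = g)"] g by (simp add: ind)
  qed
  finally show ?thesis by simp
qed

lemma orthonormal_family_extend:
  assumes "finite X" "orthonormal_family X d e" "w \<in> E" "lin_subspace E"
    and "\<And>j. j < d \<Longrightarrow> ip X w (e j) = 0" "ip X w w \<noteq> 0" "\<And>j. j < d \<Longrightarrow> e j \<in> E"
  shows "\<exists>e'. orthonormal_family X (Suc d) e' \<and> (\<forall>j<Suc d. e' j \<in> E)"
proof -
  define b where "b = (\<lambda>g. (1 / sqrt (ip X w w)) * w g)"
  have pos: "ip X w w > 0" using ip_self_nonneg[of X w] assms by linarith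
  have bb: "ip X b b = 1"
    using pos unfolding b_def ip_scale_left ip_scale_right by (simp add: field_simps)
  have be: "ip X b (e j) = 0" "ip X (e j) b = 0" if "j < d" for j
    using assms(5)[OF that] ip_commute[of X "e j" b] ip_scale_left[of X "1 / sqrt (ip X w w)" w "e j"]
    unfolding b_def by simp_all
  have "b \<in> E" using assms(3,4) unfolding b_def lin_subspace_def by blast
  moreover have "orthonormal_family X (Suc d) (e(d := b))"
    using assms(2) bb be by (auto simp: orthonormal_family_def less_Suc_eq)
  ultimately show ?thesis using assms(7) by (intro exI[of _ "e(d := b)"]) (auto simp: less_Suc_eq)
qed

text \<open>An orthonormal family in \<open>E\<close> of greatest length is a basis, since a nonzero
  remainder of a projection could be normalised and appended. The cardinality of \<open>X\<close>
  bounds the lengths.\<close>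

lemma onb_of_exists:
  assumes X: "finite X" and E: "lin_subspace E"
  shows "\<exists>d e. onb_of X E d e"
proof -
  let ?P = "\<lambda>d. \<exists>e. orthonormal_family X d e \<and> (\<forall>j<d. e j \<in> E)"
  have "?P 0" by (simp add: orthonormal_family_def)
  moreover have "\<And>d. ?P d \<Longrightarrow> d \<le> card X" using orthonormal_family_card_le[OF X] by blast
  ultimately obtain d where d: "?P d" "\<And>d'. ?P d' \<Longrightarrow> d' \<le> d"
    using Nat.ex_has_greatest_nat[of ?P 0 "card X"] by (metis (no_types, lifting))
  then obtain e where e: "orthonormal_family X d e" "\<And>j. j < d \<Longrightarrow> e j \<in> E" by blast
  have "v g = (\<Sum>j<d. ip X v (e j) * e j g)" if v: "v \<in> E" and g: "g \<in> X" for v g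
  proof (rule ccontr)
    assume neq: "v g \<noteq> (\<Sum>j<d. ip X v (e j) * e j g)"
    define w where "w = (\<lambda>g. v g - (\<Sum>j<d. ip X v (e j) * e j g))"
    have "w \<in> E" unfolding w_def
      by (intro lin_subspace_diff[OF E v] lin_subspace_sum[OF E]) (use e in auto)
    moreover have "ip X w (e j) = 0" if "j < d" for j
      using orthonormal_coeff[OF e(1) that] by (simp add: w_def ip_diff_left)
    moreover have "ip X w w \<noteq> 0" using neq g by (auto simp: ip_self_eq_0_iff[OF X] w_def)
    ultimately have "?P (Suc d)" using orthonormal_family_extend[OF X e(1) _ E _ _ e(2)] by blast
    from d(2)[OF this] show False by simp
  qed
  with e show ?thesis unfolding onb_of_def by blast
qed

text \<open>Double counting of the squared coefficients between the two families: summed along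
  \<open>e\<close> they give 1 for each \<open>b i\<close>, summed along \<open>b\<close> at most 1
  for each \<open>e j\<close>.\<close>

lemma onb_of_dim_ge:
  assumes "onb_of X E d e" "orthonormal_family X m b" "\<And>i. i < m \<Longrightarrow> b i \<in> E"
  shows "m \<le> d"
proof -
  have on: "orthonormal_family X d e" using assms(1) by (simp add: onb_of_def)
  have "ip X (b i) (b i) = (\<Sum>j<d. (ip X (b i) (e j))\<^sup>2)" if "i < m" for i
  proof -
    have "ip X (b i) (b i) = ip X (\<lambda>g. \<Sum>j<d. ip X (b i) (e j) * e j g) (\<lambda>g. \<Sum>j<d. ip X (b i) (e j) * e j g)"
      using assms(1) assms(3)[OF that] by (intro ip_cong) (auto simp: onb_of_def)
    then show ?thesis by (simp add: orthonormal_combination[OF on] power2_eq_square)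
  qed
  then have "real m = (\<Sum>i<m. \<Sum>j<d. (ip X (b i) (e j))\<^sup>2)"
    using assms(2) by (simp add: orthonormal_familyD)
  also have "\<dots> = (\<Sum>j<d. \<Sum>i<m. (ip X (e j) (b i))\<^sup>2)"
    by (subst sum.swap) (simp add: ip_commute)
  also have "\<dots> \<le> (\<Sum>j<d. ip X (e j) (e j))" by (intro sum_mono bessel assms)
  also have "\<dots> = real d" using on by (simp add: orthonormal_familyD)
  finally show ?thesis by simp
qed

section \<open>Minimisation over the orthogonal group\<close>

text \<open>Entries outside the \<open>d\<close> by \<open>d\<close> block are pinned to 0, so that
  the set is compact among all functions. Row relations make rotated families orthonormal; column
  relations give Parseval's identity and invariance of the trace.\<close>

definition orthogonal_matrices :: "nat \<Rightarrow> (nat \<Rightarrow> nat \<Rightarrow> real) set" where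
  "orthogonal_matrices d = {U. (\<forall>j l. d \<le> j \<or> d \<le> l \<longrightarrow> U j l = 0) \<and>
     (\<forall>j k. j < d \<and> k < d \<longrightarrow> (\<Sum>l<d. U j l * U k l) = of_bool (j = k)) \<and>
     (\<forall>l m. l < d \<and> m < d \<longrightarrow> (\<Sum>j<d. U j l * U j m) = of_bool (l = m))}"

lemma continuous_on_entry: "continuous_on S (\<lambda>U :: nat \<Rightarrow> nat \<Rightarrow> real. U j l)"
proof -
  have "continuous_on S (\<lambda>U :: nat \<Rightarrow> nat \<Rightarrow> real. U j)"
    by (rule continuous_on_product_then_coordinatewise[OF continuous_on_id])
  then show ?thesis by (rule continuous_on_product_then_coordinatewise)
qed

lemma compact_PiE_UNIV:
  fixes C :: "'i \<Rightarrow> 'b :: topological_space set"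
  assumes "\<And>i. compact (C i)"
  shows "compact (PiE UNIV C)"
  using assms compactin_PiE[of "\<lambda>_. euclidean" UNIV C]
  by (simp add: euclidean_product_topology)

lemma orthogonal_entry_bound:
  assumes "U \<in> orthogonal_matrices d"
  shows "U j l \<in> {-1..1}"
proof (cases "j < d \<and> l < d")
  case True
  have "(U j l)\<^sup>2 \<le> (\<Sum>l<d. U j l * U j l)"
    using True member_le_sum[of l "{..<d}" "\<lambda>l. U j l * U j l"] by (simp add: power2_eq_square)
  also have "\<dots> = 1" using assms True by (simp add: orthogonal_matrices_def)
  finally have "\<bar>U j l\<bar> \<le> 1" by (simp add: abs_square_le_1)
  then show ?thesis by auto
qed (use assms in \<open>auto simp: orthogonal_matrices_def\<close>)

text \<open>The defining equations are closed conditions in the product topology, and all entries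
  lie in a product of intervals, compact by Tychonoff's theorem.\<close>

lemma compact_orthogonal_matrices: "compact (orthogonal_matrices d)"
proof -
  let ?C = "PiE UNIV (\<lambda>_. PiE UNIV (\<lambda>_. {-1..1})) :: (nat \<Rightarrow> nat \<Rightarrow> real) set"
  have "closed (orthogonal_matrices d)" unfolding orthogonal_matrices_def
    by (intro closed_Collect_conj closed_Collect_all closed_Collect_imp open_Collect_const
        closed_Collect_eq continuous_on_sum continuous_on_mult continuous_on_entry continuous_on_const)
  moreover have "compact ?C" by (intro compact_PiE_UNIV) simp
  moreover have "orthogonal_matrices d \<subseteq> ?C" using orthogonal_entry_bound by auto
  ultimately show ?thesis by (metis compact_Int_closed inf.absorb_iff2)
qed

lemma orthogonal_matrices_attain_min:
  fixes \<Psi> :: "(nat \<Rightarrow> nat \<Rightarrow> real) \<Rightarrow> real"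
  assumes "continuous_on (orthogonal_matrices d) \<Psi>"
  obtains U where "U \<in> orthogonal_matrices d" "\<And>V. V \<in> orthogonal_matrices d \<Longrightarrow> \<Psi> U \<le> \<Psi> V"
proof -
  have "(\<lambda>j l. of_bool (j = l \<and> j < d)) \<in> orthogonal_matrices d"
    by (auto simp: orthogonal_matrices_def of_bool_conj)
  then show ?thesis
    using continuous_attains_inf[OF compact_orthogonal_matrices _ assms] that by blast
qed

section \<open>Symmetric forms under rotations in coordinate planes\<close>

definition bil :: "nat \<Rightarrow> (nat \<Rightarrow> nat \<Rightarrow> real) \<Rightarrow> (nat \<Rightarrow> real) \<Rightarrow> (nat \<Rightarrow> real) \<Rightarrow> real" where
  "bil d T x y = (\<Sum>l<d. \<Sum>m<d. x l * y m * T l m)"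

definition conj_mat :: "nat \<Rightarrow> (nat \<Rightarrow> nat \<Rightarrow> real) \<Rightarrow> (nat \<Rightarrow> nat \<Rightarrow> real) \<Rightarrow> nat \<Rightarrow> nat \<Rightarrow> real" where
  "conj_mat d U T j k = bil d T (U j) (U k)"

definition sym_mat :: "nat \<Rightarrow> (nat \<Rightarrow> nat \<Rightarrow> real) \<Rightarrow> bool" where
  "sym_mat d T \<longleftrightarrow> (\<forall>j<d. \<forall>k<d. T j k = T k j)"

lemma bil_left: "bil d T (\<lambda>l. a * x l + b * y l) z = a * bil d T x z + b * bil d T y z"
  by (simp add: bil_def sum.distrib sum_distrib_left algebra_simps)

lemma bil_right: "bil d T z (\<lambda>l. a * x l + b * y l) = a * bil d T z x + b * bil d T z y"
  by (simp add: bil_def sum.distrib sum_distrib_left algebra_simps)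

lemma bil_commute:
  assumes "sym_mat d T"
  shows "bil d T x y = bil d T y x"
  unfolding bil_def
  by (subst sum.swap, intro sum.cong refl) (use assms in \<open>simp add: sym_mat_def\<close>)

lemma sym_mat_conj: "sym_mat d T \<Longrightarrow> sym_mat d (conj_mat d U T)"
  by (auto simp: sym_mat_def[of d "conj_mat d U T"] conj_mat_def bil_commute)

lemma continuous_on_conj_mat: "continuous_on S (\<lambda>U. conj_mat d U T j k)"
  unfolding conj_mat_def bil_def by (intro continuous_intros continuous_on_entry)

text \<open>A Givens rotation acting from the left: rows \<open>j\<close> and \<open>k\<close> are
  turned by the angle \<open>t\<close> in the plane they span, and \<open>t = 0\<close> gives back
  \<open>U\<close>.\<close>

definition givens :: "nat \<Rightarrow> nat \<Rightarrow> real \<Rightarrow> (nat \<Rightarrow> nat \<Rightarrow> real) \<Rightarrow> nat \<Rightarrow> nat \<Rightarrow> real" where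
  "givens j k t U = U(j := \<lambda>l. cos t * U j l + sin t * U k l,
                      k := \<lambda>l. - sin t * U j l + cos t * U k l)"

lemma sum_split_two:
  fixes f :: "nat \<Rightarrow> 'b :: comm_monoid_add"
  assumes "j < d" "k < d" "j \<noteq> k"
  shows "(\<Sum>p<d. f p) = f j + f k + (\<Sum>p\<in>{..<d} - {j, k}. f p)"
proof -
  have "(\<Sum>p<d. f p) = f j + (\<Sum>p\<in>{..<d} - {j}. f p)" using assms by (intro sum.remove) auto
  also have "(\<Sum>p\<in>{..<d} - {j}. f p) = f k + (\<Sum>p\<in>{..<d} - {j} - {k}. f p)"
    using assms by (intro sum.remove) auto
  also have "{..<d} - {j} - {k} = {..<d} - {j, k}" by auto
  finally show ?thesis by (simp add: add.assoc)
qed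

lemma sin_cos_combination: "sin t * (sin t * a) + cos t * (cos t * a) = (a :: real)"
  using sin_cos_squared_add[of t] by (simp add: power2_eq_square flip: mult.assoc distrib_right)

lemma givens_orthogonal:
  assumes U: "U \<in> orthogonal_matrices d" and jk: "j < d" "k < d" "j \<noteq> k"
  shows "givens j k t U \<in> orthogonal_matrices d"
proof -
  let ?V = "givens j k t U"
  define r where "r = (\<lambda>x y. \<Sum>l<d. x l * y l :: real)"
  have lin: "r (\<lambda>l. a * x l + b * y l) z = a * r x z + b * r y z"
    "r z (\<lambda>l. a * x l + b * y l) = a * r z x + b * r z y" for a b x y z
    by (simp_all add: r_def sum.distrib sum_distrib_left algebra_simps)
  have row: "r (U p) (U q) = of_bool (p = q)" if "p < d" "q < d" for p q
    using U that by (simp add: orthogonal_matrices_def r_def)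
  have V: "?V j = (\<lambda>l. cos t * U j l + sin t * U k l)"
    "?V k = (\<lambda>l. - sin t * U j l + cos t * U k l)"
    "\<And>p. p \<noteq> j \<Longrightarrow> p \<noteq> k \<Longrightarrow> ?V p = U p"
    using jk by (simp_all add: givens_def)
  have sc: "sin t * sin t + cos t * cos t = 1" using sin_cos_combination[of t 1] by simp
  have "r (?V p) (?V q) = of_bool (p = q)" if "p < d" "q < d" for p q
    using that jk sc
    by (cases "p = j"; cases "p = k"; cases "q = j"; cases "q = k")
      (simp add: V lin row add.commute del: mult_minus_left; simp add: algebra_simps)+
  then have "\<forall>p q. p < d \<and> q < d \<longrightarrow> (\<Sum>l<d. ?V p l * ?V q l) = of_bool (p = q)"
    by (simp add: r_def)
  moreover have "(\<Sum>p<d. ?V p l * ?V p m) = of_bool (l = m)" if "l < d" "m < d" for l m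
  proof -
    have "?V j l * ?V j m + ?V k l * ?V k m
        = (sin t * (sin t * (U j l * U j m)) + cos t * (cos t * (U j l * U j m)))
        + (sin t * (sin t * (U k l * U k m)) + cos t * (cos t * (U k l * U k m)))"
      using jk by (simp add: givens_def algebra_simps)
    also have "\<dots> = U j l * U j m + U k l * U k m" by (simp only: sin_cos_combination)
    finally have "(\<Sum>p<d. ?V p l * ?V p m) = (\<Sum>p<d. U p l * U p m)"
      using jk by (simp add: sum_split_two[OF jk]) (simp add: givens_def)
    then show ?thesis using U that by (simp add: orthogonal_matrices_def)
  qed
  moreover have "?V p l = 0" if "d \<le> p \<or> d \<le> l" for p l
    using that U jk by (auto simp: givens_def orthogonal_matrices_def)
  ultimately show ?thesis by (simp add: orthogonal_matrices_def)
qed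

text \<open>Only diagonal entries are recorded, as both functions minimised below depend on the
  diagonal alone.\<close>

lemma conj_mat_givens:
  fixes U :: "nat \<Rightarrow> nat \<Rightarrow> real" and t :: real
  assumes T: "sym_mat d T" and jk: "j \<noteq> k"
  defines "C \<equiv> conj_mat d U T" and "C' \<equiv> conj_mat d (givens j k t U) T"
  shows "C' j j = (cos t)\<^sup>2 * C j j + 2 * (sin t * cos t) * C j k + (sin t)\<^sup>2 * C k k"
    and "C' k k = (sin t)\<^sup>2 * C j j - 2 * (sin t * cos t) * C j k + (cos t)\<^sup>2 * C k k"
    and "\<And>p. p \<noteq> j \<Longrightarrow> p \<noteq> k \<Longrightarrow> C' p p = C p p"
  using jk bil_commute[OF T, of "U k" "U j"]
  by (simp_all add: C_def C'_def conj_mat_def givens_def bil_left bil_right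
      power2_eq_square algebra_simps del: mult_minus_left)

text \<open>
  At an orthogonal matrix maximising the sum of the squared diagonal entries, all off-diagonal
  entries vanish, as otherwise a rotation in a coordinate plane would increase that sum.
\<close>

lemma spectral_sym_mat:
  assumes T: "sym_mat d T"
  shows "\<exists>U\<in>orthogonal_matrices d. \<forall>j<d. \<forall>k<d. j \<noteq> k \<longrightarrow> conj_mat d U T j k = 0"
proof -
  let ?\<Psi> = "\<lambda>U. - (\<Sum>j<d. (conj_mat d U T j j)\<^sup>2)"
  have "continuous_on (orthogonal_matrices d) ?\<Psi>"
    by (intro continuous_intros continuous_on_conj_mat)
  then obtain U where U: "U \<in> orthogonal_matrices d"
    and min: "\<And>V. V \<in> orthogonal_matrices d \<Longrightarrow> ?\<Psi> U \<le> ?\<Psi> V"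
    by (rule orthogonal_matrices_attain_min) blast
  define C where "C = conj_mat d U T"
  have "C j k = 0" if jk: "j < d" "k < d" "j \<noteq> k" for j k
  proof (rule ccontr)
    assume c: "C j k \<noteq> 0"
    define \<delta> r where "\<delta> = C j j - C k k" and "r = sqrt (\<delta>\<^sup>2 + (2 * C j k)\<^sup>2)"
    have "(2 * C j k)\<^sup>2 > 0" using c by simp
    then have r2: "r\<^sup>2 = \<delta>\<^sup>2 + (2 * C j k)\<^sup>2" and r: "r > 0"
      by (auto simp: r_def intro: add_nonneg_pos)
    have "(\<delta> / r)\<^sup>2 + (2 * C j k / r)\<^sup>2 = (\<delta>\<^sup>2 + (2 * C j k)\<^sup>2) / r\<^sup>2"
      by (simp only: power_divide add_divide_distrib)
    also have "\<dots> = 1" unfolding r2[symmetric] using r by simp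
    finally have "(\<delta> / r)\<^sup>2 + (2 * C j k / r)\<^sup>2 = 1" .
    then obtain s where s: "\<delta> / r = cos s" "2 * C j k / r = sin s"
      using sincos_total_2pi by metis
    \<comment> \<open>A rotation by \<open>t\<close> turns the vector (difference of the two
      diagonal entries, twice the off-diagonal entry) by \<open>2 * t\<close>. Half its polar angle
      brings the difference to the full length \<open>r\<close>. The sum of the two entries is
      fixed, so the sum of their squares grows with the difference.\<close>
    define t where "t = s / 2"
    have ct: "cos s = (cos t)\<^sup>2 - (sin t)\<^sup>2" "sin s = 2 * sin t * cos t"
      using cos_double[of t] sin_double[of t] by (simp_all add: t_def)
    define C' where "C' = conj_mat d (givens j k t U) T"
    note C' = conj_mat_givens[OF T jk(3), where U = U and t = t, folded C_def C'_def]
    have "C' j j + C' k k = ((sin t)\<^sup>2 + (cos t)\<^sup>2) * (C j j + C k k)"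
      unfolding C' by algebra
    then have sum: "C' j j + C' k k = C j j + C k k" by simp
    have "C' j j - C' k k = cos s * \<delta> + sin s * (2 * C j k)"
      unfolding C' ct \<delta>_def by algebra
    also have "\<dots> = r" using r2 r unfolding s[symmetric]
      by (simp add: field_simps power2_eq_square)
    finally have diff: "C' j j - C' k k = r" .
    have "?\<Psi> U \<le> ?\<Psi> (givens j k t U)" by (intro min givens_orthogonal U jk)
    then have "(C' j j)\<^sup>2 + (C' k k)\<^sup>2 \<le> (C j j)\<^sup>2 + (C k k)\<^sup>2"
      unfolding sum_split_two[OF jk] C_def[symmetric] C'_def[symmetric] by (simp add: C'(3))
    moreover have "2 * ((C' j j)\<^sup>2 + (C' k k)\<^sup>2) = (C' j j + C' k k)\<^sup>2 + r\<^sup>2"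
      unfolding diff[symmetric] by algebra
    moreover have "2 * ((C j j)\<^sup>2 + (C k k)\<^sup>2) = (C j j + C k k)\<^sup>2 + \<delta>\<^sup>2"
      unfolding \<delta>_def by algebra
    ultimately have "r\<^sup>2 \<le> \<delta>\<^sup>2" using sum by simp
    with r2 \<open>(2 * C j k)\<^sup>2 > 0\<close> show False by simp
  qed
  then show ?thesis using U unfolding C_def by blast
qed

section \<open>Second-order conditions at a minimum\<close>

lemma second_derivative_at_min:
  fixes h h' :: "real \<Rightarrow> real"
  assumes "\<And>t. h 0 \<le> h t" "\<And>t. (h has_real_derivative h' t) (at t)"
    and "(h' has_real_derivative D) (at 0)"
  shows "D \<ge> 0"
proof (rule ccontr)
  assume "\<not> D \<ge> 0"
  then have "D < 0" by simp
  have h0: "h' 0 = 0" using DERIV_local_min[OF assms(2), of 1] assms(1) by simp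
  obtain \<epsilon> where \<epsilon>: "\<epsilon> > 0" "\<And>t. 0 < t \<Longrightarrow> t < \<epsilon> \<Longrightarrow> h' t < 0"
    using DERIV_neg_dec_right[OF assms(3) \<open>D < 0\<close>] h0 by auto
  obtain z where z: "0 < z" "z < \<epsilon> / 2" "h (\<epsilon> / 2) - h 0 = (\<epsilon> / 2 - 0) * h' z"
    using MVT2[of 0 "\<epsilon> / 2" h h'] \<epsilon>(1) assms(2) by auto
  have "h' z < 0" using \<epsilon> z by simp
  then have "(\<epsilon> / 2 - 0) * h' z < 0" using \<epsilon>(1) by (simp add: mult_pos_neg)
  then show False using assms(1)[of "\<epsilon> / 2"] z(3) by linarith
qed

text \<open>Here \<open>a\<close>, \<open>b\<close>, \<open>c\<close> are the entries of a symmetric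
  2 by 2 block and \<open>x\<close>, \<open>y\<close> its diagonal after a rotation by
  \<open>t\<close>. The trace is constant, so the derivatives of \<open>x\<close> and
  \<open>y\<close> are opposite. With first derivative \<open>2 * c\<close> and second derivative
  \<open>2 * (b - a)\<close> of \<open>x\<close> at 0, nonnegativity of the second derivative of the
  sum is twice the claim.\<close>

lemma exp_rotation_second_derivative:
  fixes a b c :: "'i \<Rightarrow> real"
  defines "x \<equiv> \<lambda>i t. (cos t)\<^sup>2 * a i + 2 * (sin t * cos t) * c i + (sin t)\<^sup>2 * b i"
    and "y \<equiv> \<lambda>i t. (sin t)\<^sup>2 * a i - 2 * (sin t * cos t) * c i + (cos t)\<^sup>2 * b i"
  assumes min: "\<And>t. (\<Sum>i\<in>I. exp (a i) + exp (b i)) \<le> (\<Sum>i\<in>I. exp (x i t) + exp (y i t))"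
  shows "(\<Sum>i\<in>I. (a i - b i) * (exp (a i) - exp (b i))) \<le> (\<Sum>i\<in>I. 2 * (c i)\<^sup>2 * (exp (a i) + exp (b i)))"
proof -
  define x' where "x' = (\<lambda>i t. 2 * (sin t * cos t) * (b i - a i) + 2 * ((cos t)\<^sup>2 - (sin t)\<^sup>2) * c i)"
  define h where "h = (\<lambda>t. \<Sum>i\<in>I. exp (x i t) + exp (y i t))"
  define h' where "h' = (\<lambda>t. \<Sum>i\<in>I. exp (x i t) * x' i t - exp (y i t) * x' i t)"
  have dx: "(x i has_real_derivative x' i t) (at t)" "(y i has_real_derivative - x' i t) (at t)" for i t
    unfolding x_def y_def x'_def
    by (auto intro!: derivative_eq_intros simp: power2_eq_square algebra_simps)
  have dx': "(x' i has_real_derivative 2 * (b i - a i)) (at 0)" for i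
    unfolding x'_def by (auto intro!: derivative_eq_intros)
  have at0: "x i 0 = a i" "y i 0 = b i" "x' i 0 = 2 * c i" for i
    by (simp_all add: x_def y_def x'_def)
  have dh: "(h has_real_derivative h' t) (at t)" for t unfolding h_def h'_def
    by (auto intro!: derivative_eq_intros dx sum.cong)
  let ?D = "\<Sum>i\<in>I. 4 * (c i)\<^sup>2 * (exp (a i) + exp (b i)) - 2 * ((a i - b i) * (exp (a i) - exp (b i)))"
  have "(h' has_real_derivative ?D) (at 0)" unfolding h'_def
    by (rule derivative_eq_intros dx dx' refl)+
      (auto simp: at0 power2_eq_square algebra_simps intro!: sum.cong)
  then have "0 \<le> ?D" using second_derivative_at_min[of h h'] min dh by (auto simp: h_def at0)
  also have "?D = 2 * ((\<Sum>i\<in>I. 2 * (c i)\<^sup>2 * (exp (a i) + exp (b i))) - (\<Sum>i\<in>I. (a i - b i) * (exp (a i) - exp (b i))))"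
    by (simp add: sum_subtractf sum.distrib sum_distrib_left algebra_simps)
  finally show ?thesis by simp
qed

text \<open>
  The inequality is the sum, over all pairs \<open>j, k\<close>, of the second-order conditions at a
  minimiser of \<open>\<Sum>\<^sub>i \<Sum>\<^sub>j exp (W\<^sub>i\<^sub>j\<^sub>j)\<close>.
\<close>

lemma exp_trace_minimizer:
  assumes W: "\<And>i. i \<in> I \<Longrightarrow> sym_mat d (W i)"
  shows "\<exists>U\<in>orthogonal_matrices d.
    (\<Sum>i\<in>I. \<Sum>j<d. exp (conj_mat d U (W i) j j) *
       (d * conj_mat d U (W i) j j - (\<Sum>k<d. conj_mat d U (W i) k k)
          - 2 * (\<Sum>k<d. (conj_mat d U (W i) j k)\<^sup>2))) \<le> 0"
proof -
  let ?\<Psi> = "\<lambda>U. \<Sum>i\<in>I. \<Sum>j<d. exp (conj_mat d U (W i) j j)"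
  have "continuous_on (orthogonal_matrices d) ?\<Psi>"
    by (intro continuous_intros continuous_on_conj_mat)
  then obtain U where U: "U \<in> orthogonal_matrices d"
    and min: "\<And>V. V \<in> orthogonal_matrices d \<Longrightarrow> ?\<Psi> U \<le> ?\<Psi> V"
    by (rule orthogonal_matrices_attain_min) blast
  define C where "C = (\<lambda>i. conj_mat d U (W i))"
  let ?e = "\<lambda>i j. exp (C i j j)"
  have pair: "(\<Sum>i\<in>I. (C i j j - C i k k) * (?e i j - ?e i k))
      \<le> (\<Sum>i\<in>I. 2 * (C i j k)\<^sup>2 * (?e i j + ?e i k))" if "j < d" "k < d" for j k
  \<comment> \<open>For equal indices the left-hand side is 0. Including these pairs costs nothing
    and completes the row sums \<open>\<Sum>k<d. (C i j k)\<^sup>2\<close>.\<close>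
  proof (cases "j = k")
    case True
    then show ?thesis by (simp add: sum_nonneg)
  next
    case False
    note jk = that False
    show ?thesis
    proof (rule exp_rotation_second_derivative)
      fix t
      define C' where "C' = (\<lambda>i. conj_mat d (givens j k t U) (W i))"
      have "?\<Psi> U \<le> ?\<Psi> (givens j k t U)" by (intro min givens_orthogonal U jk)
      then have "(\<Sum>i\<in>I. ?e i j + ?e i k) + (\<Sum>i\<in>I. \<Sum>p\<in>{..<d} - {j, k}. exp (C i p p))
          \<le> (\<Sum>i\<in>I. exp (C' i j j) + exp (C' i k k)) + (\<Sum>i\<in>I. \<Sum>p\<in>{..<d} - {j, k}. exp (C' i p p))"
        unfolding sum_split_two[OF jk] by (simp add: sum.distrib C_def C'_def)
      also have "(\<Sum>i\<in>I. \<Sum>p\<in>{..<d} - {j, k}. exp (C' i p p)) = (\<Sum>i\<in>I. \<Sum>p\<in>{..<d} - {j, k}. exp (C i p p))"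
        by (intro sum.cong refl) (auto simp: C'_def C_def conj_mat_givens(3)[OF W jk(3)])
      finally have "(\<Sum>i\<in>I. ?e i j + ?e i k) \<le> (\<Sum>i\<in>I. exp (C' i j j) + exp (C' i k k))" by simp
      also have "\<dots> = (\<Sum>i\<in>I. exp ((cos t)\<^sup>2 * C i j j + 2 * (sin t * cos t) * C i j k + (sin t)\<^sup>2 * C i k k)
         + exp ((sin t)\<^sup>2 * C i j j - 2 * (sin t * cos t) * C i j k + (cos t)\<^sup>2 * C i k k))"
        by (intro sum.cong refl)
          (simp add: C'_def C_def conj_mat_givens(1,2)[OF W jk(3)])
      finally show "(\<Sum>i\<in>I. ?e i j + ?e i k) \<le> \<dots>" .
    qed
  qed
  \<comment> \<open>Summing over ordered pairs makes the contributions of \<open>j\<close> and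
    \<open>k\<close> equal by symmetry of \<open>C i\<close>; this is the origin of the factor
    \<open>- 2\<close>.\<close>
  have id: "(\<Sum>j<d. \<Sum>k<d. 2 * (C i j k)\<^sup>2 * (?e i j + ?e i k) - (C i j j - C i k k) * (?e i j - ?e i k))
      = - 2 * (\<Sum>j<d. ?e i j * (d * C i j j - (\<Sum>k<d. C i k k) - 2 * (\<Sum>k<d. (C i j k)\<^sup>2)))"
    if i: "i \<in> I" for i
  proof -
    have sym: "C i j k = C i k j" if "j < d" "k < d" for j k
      using sym_mat_conj[OF W[OF i], of U] that by (simp add: sym_mat_def C_def)
    have 1: "(\<Sum>j<d. \<Sum>k<d. (C i j k)\<^sup>2 * ?e i k) = (\<Sum>j<d. ?e i j * (\<Sum>k<d. (C i j k)\<^sup>2))"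
      by (subst sum.swap) (auto simp: sum_distrib_left sym mult.commute intro!: sum.cong)
    have 2: "(\<Sum>j<d. \<Sum>k<d. (C i j k)\<^sup>2 * ?e i j) = (\<Sum>j<d. ?e i j * (\<Sum>k<d. (C i j k)\<^sup>2))"
      by (auto simp: sum_distrib_left mult.commute intro!: sum.cong)
    have 3: "(\<Sum>j<d. \<Sum>k<d. C i j j * ?e i k) = (\<Sum>k<d. C i k k) * (\<Sum>j<d. ?e i j)"
      "(\<Sum>j<d. \<Sum>k<d. C i k k * ?e i j) = (\<Sum>k<d. C i k k) * (\<Sum>j<d. ?e i j)"
      by (simp_all add: sum_product mult.commute) (subst sum.swap, simp add: mult.commute)
    have 4: "(\<Sum>j<d. \<Sum>k<d. C i j j * ?e i j) = d * (\<Sum>j<d. C i j j * ?e i j)"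
      "(\<Sum>j<d. \<Sum>k<d. C i k k * ?e i k) = d * (\<Sum>j<d. C i j j * ?e i j)"
      by (simp_all add: sum_distrib_left)
    have 5: "(\<Sum>j<d. ?e i j * (d * C i j j - s - 2 * R j))
      = d * (\<Sum>j<d. C i j j * ?e i j) - s * (\<Sum>j<d. ?e i j) - 2 * (\<Sum>j<d. ?e i j * R j)" for s R
      by (simp add: sum.distrib sum_subtractf sum_distrib_left algebra_simps)
    have "(\<Sum>j<d. \<Sum>k<d. 2 * (C i j k)\<^sup>2 * (?e i j + ?e i k) - (C i j j - C i k k) * (?e i j - ?e i k))
      = 2 * (\<Sum>j<d. \<Sum>k<d. (C i j k)\<^sup>2 * ?e i j) + 2 * (\<Sum>j<d. \<Sum>k<d. (C i j k)\<^sup>2 * ?e i k)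
        - (\<Sum>j<d. \<Sum>k<d. C i j j * ?e i j) - (\<Sum>j<d. \<Sum>k<d. C i k k * ?e i k)
        + (\<Sum>j<d. \<Sum>k<d. C i j j * ?e i k) + (\<Sum>j<d. \<Sum>k<d. C i k k * ?e i j)"
      unfolding sum_distrib_left sum.distrib[symmetric] sum_subtractf[symmetric]
      by (intro sum.cong refl) algebra
    also have "\<dots> = - 2 * (\<Sum>j<d. ?e i j * (d * C i j j - (\<Sum>k<d. C i k k) - 2 * (\<Sum>k<d. (C i j k)\<^sup>2)))"
      unfolding 1 2 3 4 5 by (simp add: algebra_simps)
    finally show ?thesis .
  qed
  have "0 \<le> (\<Sum>j<d. \<Sum>k<d. \<Sum>i\<in>I. 2 * (C i j k)\<^sup>2 * (?e i j + ?e i k) - (C i j j - C i k k) * (?e i j - ?e i k))"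
    by (rule sum_nonneg, rule sum_nonneg) (use pair in \<open>simp add: sum_subtractf\<close>)
  also have "\<dots> = (\<Sum>j<d. \<Sum>i\<in>I. \<Sum>k<d. 2 * (C i j k)\<^sup>2 * (?e i j + ?e i k) - (C i j j - C i k k) * (?e i j - ?e i k))"
    by (intro sum.cong refl sum.swap)
  also have "\<dots> = (\<Sum>i\<in>I. \<Sum>j<d. \<Sum>k<d. 2 * (C i j k)\<^sup>2 * (?e i j + ?e i k) - (C i j j - C i k k) * (?e i j - ?e i k))"
    by (rule sum.swap)
  also have "\<dots> = - 2 * (\<Sum>i\<in>I. \<Sum>j<d. ?e i j * (d * C i j j - (\<Sum>k<d. C i k k) - 2 * (\<Sum>k<d. (C i j k)\<^sup>2)))"
    by (simp add: id sum_distrib_left)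
  finally show ?thesis using U unfolding C_def by (intro bexI[of _ U]) auto
qed

section \<open>Trace and products under orthogonal conjugation\<close>

lemma orthogonal_matrices_parseval:
  assumes "U \<in> orthogonal_matrices d"
  shows "(\<Sum>q<d. (\<Sum>m<d. U q m * x m) * (\<Sum>p<d. U q p * y p)) = (\<Sum>m<d. x m * y m)"
proof -
  have "(\<Sum>q<d. (\<Sum>m<d. U q m * x m) * (\<Sum>p<d. U q p * y p))
      = (\<Sum>q<d. \<Sum>m<d. \<Sum>p<d. (U q m * U q p) * (x m * y p))"
    by (simp add: sum_product algebra_simps)
  also have "\<dots> = (\<Sum>m<d. \<Sum>q<d. \<Sum>p<d. (U q m * U q p) * (x m * y p))"
    by (rule sum.swap)
  also have "\<dots> = (\<Sum>m<d. \<Sum>p<d. \<Sum>q<d. (U q m * U q p) * (x m * y p))"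
    by (intro sum.cong refl sum.swap)
  also have "\<dots> = (\<Sum>m<d. \<Sum>p<d. of_bool (m = p) * (x m * y p))"
    using assms by (intro sum.cong refl) (simp add: orthogonal_matrices_def flip: sum_distrib_right)
  finally show ?thesis by simp
qed

lemma conj_mat_right: "conj_mat d U T j k = (\<Sum>m<d. U k m * (\<Sum>l<d. U j l * T l m))"
  unfolding conj_mat_def bil_def by (subst sum.swap) (simp add: sum_distrib_left algebra_simps)

lemma conj_mat_left: "conj_mat d U T j k = (\<Sum>l<d. U j l * (\<Sum>m<d. U k m * T l m))"
  unfolding conj_mat_def bil_def by (simp add: sum_distrib_left algebra_simps)

lemma trace_conj_mat:
  assumes "U \<in> orthogonal_matrices d"
  shows "(\<Sum>j<d. conj_mat d U T j j) = (\<Sum>l<d. T l l)"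
proof -
  have "(\<Sum>j<d. conj_mat d U T j j) = (\<Sum>j<d. \<Sum>l<d. \<Sum>m<d. U j l * U j m * T l m)"
    by (simp add: conj_mat_def bil_def)
  also have "\<dots> = (\<Sum>l<d. \<Sum>j<d. \<Sum>m<d. U j l * U j m * T l m)" by (rule sum.swap)
  also have "\<dots> = (\<Sum>l<d. \<Sum>m<d. \<Sum>j<d. U j l * U j m * T l m)"
    by (intro sum.cong refl sum.swap)
  also have "\<dots> = (\<Sum>l<d. \<Sum>m<d. of_bool (l = m) * T l m)"
    using assms by (intro sum.cong refl) (simp add: orthogonal_matrices_def flip: sum_distrib_right)
  finally show ?thesis by simp
qed

text \<open>Parseval's identity inserts the rows of \<open>U\<close> between the two factors. For
  \<open>A = B = T\<close> with \<open>T\<close> symmetric, the diagonal of the conjugated square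
  consists of the squared row norms of the conjugate of \<open>T\<close>.\<close>

lemma conj_mat_mult:
  assumes "U \<in> orthogonal_matrices d"
  shows "conj_mat d U (\<lambda>l m. \<Sum>p<d. A l p * B p m) j k
    = (\<Sum>q<d. conj_mat d U A j q * conj_mat d U B q k)"
proof -
  have "(\<Sum>q<d. conj_mat d U A j q * conj_mat d U B q k)
      = (\<Sum>p<d. (\<Sum>l<d. U j l * A l p) * (\<Sum>m<d. U k m * B p m))"
    unfolding conj_mat_right[of d U A] conj_mat_left[of d U B]
    by (rule orthogonal_matrices_parseval[OF assms])
  also have "\<dots> = (\<Sum>p<d. \<Sum>l<d. \<Sum>m<d. U j l * U k m * (A l p * B p m))"
    by (simp add: sum_product algebra_simps)
  also have "\<dots> = (\<Sum>l<d. \<Sum>p<d. \<Sum>m<d. U j l * U k m * (A l p * B p m))" by (rule sum.swap)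
  also have "\<dots> = (\<Sum>l<d. \<Sum>m<d. \<Sum>p<d. U j l * U k m * (A l p * B p m))"
    by (intro sum.cong refl sum.swap)
  finally show ?thesis by (simp add: conj_mat_def bil_def sum_distrib_left)
qed

lemma conj_mat_linear:
  "conj_mat d U (\<lambda>l m. (a * A l m + B l m) / c) j k = (a * conj_mat d U A j k + conj_mat d U B j k) / c"
  by (simp add: conj_mat_def bil_def sum.distrib sum_distrib_left sum_divide_distrib
      add_divide_distrib algebra_simps)

lemma sym_mat_square:
  assumes "sym_mat d T"
  shows "sym_mat d (\<lambda>l m. \<Sum>p<d. T l p * T p m)"
  using assms unfolding sym_mat_def by (auto intro!: sum.cong simp: mult.commute)

text \<open>Contributions of a form and its negative at one basis vector, added together:
  \<open>b\<close> is the rescaled diagonal entry and \<open>q\<close> the squared row norm. The sum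
  is \<open>exp (q / 16)\<close> times an even function of \<open>b\<close>. A pair can therefore
  lower the total by at most 3, whereas an entry with \<open>\<bar>b\<bar> \<ge> 1\<close> raises it
  by at least \<open>3 * exp \<bar>b\<bar>\<close>.\<close>

lemma exp_pair_bound:
  fixes b q :: real
  assumes "q \<ge> 0"
  defines "g \<equiv> exp (b + q / 16) * (16 * b + q / 2 - 1) + exp (- b + q / 16) * (- 16 * b + q / 2 - 1)"
  shows "- 3 \<le> g" and "\<bar>b\<bar> \<ge> 1 \<Longrightarrow> 3 * exp \<bar>b\<bar> \<le> g"
proof -
  define \<beta> x y where "\<beta> = \<bar>b\<bar>" and "x = exp \<beta>" and "y = exp (- \<beta>)"
  have \<beta>: "\<beta> \<ge> 0" and xy: "x * y = 1" "x > 0" "y > 0" and x1: "x \<ge> 1"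
    by (simp_all add: \<beta>_def x_def y_def flip: exp_add)
  have yx: "y \<le> 1" using \<beta> by (simp add: y_def)
  define s where "s = 16 * \<beta> * (x - y) + (q / 2 - 1) * (x + y)"
  have e: "exp (b + q / 16) = exp b * exp (q / 16)" "exp (- b + q / 16) = exp (- b) * exp (q / 16)"
    by (rule exp_add)+
  have g: "g = exp (q / 16) * s" unfolding g_def e
    by (cases "b \<ge> 0") (simp_all add: s_def \<beta>_def x_def y_def algebra_simps)
  have s0: "16 * \<beta> * (x - y) - (x + y) \<le> s" using assms(1) xy by (simp add: s_def algebra_simps)
  \<comment> \<open>In hyperbolic terms
    \<open>cosh \<beta> - 1 \<le> 16 * \<beta> * sinh \<beta>\<close>. It gives the lower bound
    \<open>- 2\<close> for \<open>s\<close>, whatever the size of \<open>\<beta>\<close>.\<close>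
  have "x + y - 2 \<le> 16 * \<beta> * (x - y)"
  proof -
    have "1 - \<beta> \<le> y" using exp_ge_add_one_self[of "- \<beta>"] by (simp add: y_def)
    then have "x * (1 - \<beta>) \<le> x * y" using xy by (intro mult_left_mono) auto
    then have 1: "x - 1 \<le> \<beta> * x" using xy by (simp add: algebra_simps)
    have 2: "1 - y \<ge> 0" using yx by simp
    have "x + y - 2 = (x - 1) * (1 - y)" using xy by (simp add: algebra_simps)
    also have "\<dots> \<le> \<beta> * x * (1 - y)" using 1 2 by (rule mult_right_mono)
    also have "\<dots> = \<beta> * (x - 1)" using xy by (simp add: algebra_simps)
    also have "\<dots> \<le> \<beta> * (16 * (x - y))" using \<beta> yx x1 by (intro mult_left_mono) auto
    finally show ?thesis by (simp add: algebra_simps)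
  qed
  then have s2: "s \<ge> - 2" using s0 by linarith
  show "- 3 \<le> g"
  proof (cases "q \<ge> 2")
    case True
    then have "s \<ge> 0" using \<beta> x1 yx xy unfolding s_def
      by (intro add_nonneg_nonneg mult_nonneg_nonneg) auto
    then have "g \<ge> 0" by (simp add: g)
    then show ?thesis by simp
  next
    case False
    \<comment> \<open>For \<open>q < 2\<close> the factor \<open>exp (q / 16)\<close> is at most
      \<open>8 / 7\<close>, hence at most \<open>3 / 2\<close>, which takes the bound
      \<open>- 2\<close> to \<open>- 3\<close>.\<close>
    have "7 / 8 \<le> exp (- (1 / 8) :: real)" using exp_ge_add_one_self[of "- (1 / 8)"] by simp
    then have "exp (1 / 8) * (7 / 8) \<le> exp (1 / 8) * exp (- (1 / 8) :: real)"
      by (intro mult_left_mono) auto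
    then have "exp (1 / 8 :: real) \<le> 3 / 2" by (simp flip: exp_add)
    moreover have "exp (q / 16) \<le> exp (1 / 8)" using False by simp
    ultimately have e: "exp (q / 16) \<le> 3 / 2" by linarith
    have "exp (q / 16) * (- 2) \<le> g" unfolding g using s2 by (intro mult_left_mono) auto
    with e show ?thesis by linarith
  qed
  show "3 * exp \<bar>b\<bar> \<le> g" if "\<bar>b\<bar> \<ge> 1"
  proof -
    have b1: "\<beta> \<ge> 1" using that by (simp add: \<beta>_def)
    have "x \<ge> 2" using exp_ge_add_one_self[of \<beta>] b1 unfolding x_def by linarith
    then have "2 * y \<le> x * y" using xy by (intro mult_right_mono) auto
    then have y: "y \<le> 1 / 2" using xy by simp
    have "1 * (16 * (x - y)) \<le> \<beta> * (16 * (x - y))" using b1 \<open>x \<ge> 2\<close> y by (intro mult_right_mono) auto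
    then have "3 * x \<le> s" using s0 \<open>x \<ge> 2\<close> y by (simp add: algebra_simps)
    also have "s \<le> exp (q / 16) * s" using assms(1) \<open>3 * x \<le> s\<close> xy by (simp add: mult_le_cancel_right1)
    finally show ?thesis by (simp add: g x_def \<beta>_def)
  qed
qed

lemma sum_ge_single:
  fixes f :: "'i \<Rightarrow> real"
  assumes "finite A" "i \<in> A" "\<And>j. j \<in> A \<Longrightarrow> - c \<le> f j"
  shows "f i - c * (card A - 1) \<le> sum f A"
proof -
  have "(\<Sum>j\<in>A - {i}. - c) \<le> sum f (A - {i})" using assms by (intro sum_mono) auto
  moreover have "(\<Sum>j\<in>A - {i}. - c) = - c * (card A - 1)"
    using assms by (simp add: card_Diff_singleton)
  ultimately show ?thesis using assms by (simp add: sum.remove[of A i f] mult.commute)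
qed

text \<open>
  The second-order inequality for the forms \<open>\<plusminus> T\<^sub>i\<close> alone would involve the squared row norms
  \<open>q\<^sub>i\<^sub>j\<close> of \<open>T\<^sub>i\<close>, which need not be bounded. Since \<open>q\<^sub>i\<^sub>j\<close> is a diagonal entry
  of \<open>T\<^sub>i\<^sup>2\<close>, adding \<open>T\<^sub>i\<^sup>2\<close> to the form lets the left-hand side absorb it.
\<close>

lemma exists_balancing_rotation:
  fixes T :: "nat \<Rightarrow> nat \<Rightarrow> nat \<Rightarrow> real"
  assumes T: "\<And>i. i < M \<Longrightarrow> sym_mat d (T i)"
    and tr: "\<And>i. i < M \<Longrightarrow> (\<Sum>j<d. T i j j) = 0"
    and hs: "\<And>i. i < M \<Longrightarrow> (\<Sum>j<d. \<Sum>k<d. (T i j k)\<^sup>2) \<le> d"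
  shows "\<exists>U\<in>orthogonal_matrices d. \<forall>i<M. \<forall>j<d.
    \<bar>conj_mat d U (T i) j j\<bar> \<le> 16 * max 1 (ln (real M * real d)) / sqrt d"
proof -
  define I where "I = {..<M} \<times> {-1, 1 :: real}"
  define sq where "sq = (\<lambda>i l m. \<Sum>p<d. T i l p * T i p m)"
  \<comment> \<open>Division by 16 divides squared entries by 256 but the diagonal only by 16. In
    the second-order inequality the square of \<open>T i\<close> thus contributes
    \<open>d * q / 16\<close>, while the row norms cost \<open>d * q / 32\<close>; half of the gain
    remains.\<close>
  define W where "W = (\<lambda>(i, s) l m. (s * sqrt d * T i l m + sq i l m) / 16)"
  have symW: "sym_mat d (W w)" if "w \<in> I" for w
    using that T sym_mat_square[OF T] unfolding sym_mat_def W_def I_def sq_def by auto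
  obtain U where U: "U \<in> orthogonal_matrices d" and ineq:
    "(\<Sum>w\<in>I. \<Sum>j<d. exp (conj_mat d U (W w) j j) *
       (d * conj_mat d U (W w) j j - (\<Sum>k<d. conj_mat d U (W w) k k)
          - 2 * (\<Sum>k<d. (conj_mat d U (W w) j k)\<^sup>2))) \<le> 0"
    using exp_trace_minimizer[of I d W] symW by blast
  define C where "C = (\<lambda>i. conj_mat d U (T i))"
  define q where "q = (\<lambda>i j. \<Sum>k<d. (C i j k)\<^sup>2)"
  define Q where "Q = (\<lambda>i j k. \<Sum>p<d. C i j p * C i p k)"
  have symC: "C i j k = C i k j" if "i < M" "j < d" "k < d" for i j k
    using sym_mat_conj[OF T[OF that(1)], of U] that by (simp add: sym_mat_def C_def)
  have conjW: "conj_mat d U (W (i, s)) j k = (s * sqrt d * C i j k + Q i j k) / 16" for i s j k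
    by (simp add: W_def C_def Q_def sq_def conj_mat_linear conj_mat_mult[OF U])
  have Qjj: "Q i j j = q i j" if "i < M" "j < d" for i j
    using that by (auto simp: Q_def q_def power2_eq_square symC intro!: sum.cong)
  have q0: "q i j \<ge> 0" for i j by (simp add: q_def sum_nonneg)
  have trC: "(\<Sum>j<d. C i j j) = 0" if "i < M" for i
    using trace_conj_mat[OF U] tr[OF that] by (simp add: C_def)
  have trq: "(\<Sum>j<d. q i j) \<le> d" if "i < M" for i
  proof -
    have "(\<Sum>j<d. q i j) = (\<Sum>j<d. Q i j j)" using that by (simp add: Qjj)
    also have "\<dots> = (\<Sum>j<d. conj_mat d U (sq i) j j)"
      by (simp add: Q_def C_def sq_def conj_mat_mult[OF U])
    also have "\<dots> = (\<Sum>j<d. sq i j j)" by (rule trace_conj_mat[OF U])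
    also have "\<dots> = (\<Sum>j<d. \<Sum>k<d. (T i j k)\<^sup>2)"
      using T[OF that] by (auto simp: sq_def sym_mat_def power2_eq_square intro!: sum.cong)
    finally show ?thesis using hs[OF that] by simp
  qed
  \<comment> \<open>Each entry of the squared form is an inner product of two rows. Cauchy-Schwarz
    and the bound \<open>d\<close> on the sum of all squared row norms control a whole row by
    \<open>d * q i j\<close>, the same size as the contribution of the form itself.\<close>
  have Q2: "(\<Sum>k<d. (Q i j k)\<^sup>2) \<le> d * q i j" if "i < M" "j < d" for i j
  proof -
    have "(\<Sum>k<d. (Q i j k)\<^sup>2) \<le> (\<Sum>k<d. q i j * q i k)"
    proof (rule sum_mono)
      fix k assume "k \<in> {..<d}"
      then have k: "k < d" by simp
      have "(Q i j k)\<^sup>2 \<le> (\<Sum>p<d. (C i j p)\<^sup>2) * (\<Sum>p<d. (C i p k)\<^sup>2)"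
        unfolding Q_def by (rule Cauchy_Schwarz_ineq_sum)
      also have "(\<Sum>p<d. (C i p k)\<^sup>2) = q i k" unfolding q_def
        using that k by (auto simp: symC intro!: sum.cong)
      finally show "(Q i j k)\<^sup>2 \<le> q i j * q i k" by (simp add: q_def)
    qed
    also have "\<dots> = q i j * (\<Sum>k<d. q i k)" by (simp add: sum_distrib_left)
    also have "\<dots> \<le> q i j * d" using trq[OF that(1)] q0 by (intro mult_left_mono) auto
    finally show ?thesis by (simp add: mult.commute)
  qed
  define b where "b = (\<lambda>i j. sqrt d * C i j j / 16)"
  define t where "t = (\<lambda>i j s. exp (s * b i j + q i j / 16) * (s * 16 * b i j + q i j / 2 - 1))"
  have term_le: "d / 16 * t i j s \<le> exp (conj_mat d U (W (i, s)) j j) *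
       (d * conj_mat d U (W (i, s)) j j - (\<Sum>k<d. conj_mat d U (W (i, s)) k k)
          - 2 * (\<Sum>k<d. (conj_mat d U (W (i, s)) j k)\<^sup>2))"
    if i: "i < M" and j: "j < d" and s: "s \<in> {-1, 1}" for i j s
  proof -
    have Wjj: "conj_mat d U (W (i, s)) k k = (s * sqrt d * C i k k + q i k) / 16" if "k < d" for k
      using that i by (simp add: conjW Qjj)
    have "(\<Sum>k<d. conj_mat d U (W (i, s)) k k) = (\<Sum>k<d. (s * sqrt d * C i k k + q i k) / 16)"
      by (simp add: Wjj)
    also have "\<dots> = (s * sqrt d * (\<Sum>k<d. C i k k) + (\<Sum>k<d. q i k)) / 16"
      by (simp add: sum.distrib sum_distrib_left flip: sum_divide_distrib)
    also have "\<dots> \<le> d / 16" using trC[OF i] trq[OF i] by simp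
    finally have 1: "(\<Sum>k<d. conj_mat d U (W (i, s)) k k) \<le> d / 16" .
    have "(\<Sum>k<d. (conj_mat d U (W (i, s)) j k)\<^sup>2) \<le> (\<Sum>k<d. (d * (C i j k)\<^sup>2 + (Q i j k)\<^sup>2) / 128)"
    proof (rule sum_mono)
      fix k
      have "(conj_mat d U (W (i, s)) j k)\<^sup>2 = (s * sqrt d * C i j k + Q i j k)\<^sup>2 / 256"
        by (simp add: conjW power_divide)
      also have "(s * sqrt d * C i j k + Q i j k)\<^sup>2 \<le> 2 * (s * sqrt d * C i j k)\<^sup>2 + 2 * (Q i j k)\<^sup>2"
        using sum_squares_bound[of "s * sqrt d * C i j k" "Q i j k"]
        by (simp add: power2_sum)
      also have "(s * sqrt d * C i j k)\<^sup>2 = d * (C i j k)\<^sup>2" using s by (auto simp: power_mult_distrib)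
      finally show "(conj_mat d U (W (i, s)) j k)\<^sup>2 \<le> (d * (C i j k)\<^sup>2 + (Q i j k)\<^sup>2) / 128" by simp
    qed
    also have "\<dots> = (d * q i j + (\<Sum>k<d. (Q i j k)\<^sup>2)) / 128"
      by (simp add: q_def sum.distrib sum_distrib_left flip: sum_divide_distrib)
    also have "\<dots> \<le> d * q i j / 64" using Q2[OF i j] by simp
    finally have 2: "(\<Sum>k<d. (conj_mat d U (W (i, s)) j k)\<^sup>2) \<le> d * q i j / 64" .
    have e: "exp (conj_mat d U (W (i, s)) j j) = exp (s * b i j + q i j / 16)"
      by (simp add: Wjj[OF j] b_def add_divide_distrib)
    have "d / 16 * (s * 16 * b i j + q i j / 2 - 1) = d * conj_mat d U (W (i, s)) j j - d / 16 - 2 * (d * q i j / 64)"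
      by (simp add: Wjj[OF j] b_def field_simps)
    also have "\<dots> \<le> d * conj_mat d U (W (i, s)) j j - (\<Sum>k<d. conj_mat d U (W (i, s)) k k)
          - 2 * (\<Sum>k<d. (conj_mat d U (W (i, s)) j k)\<^sup>2)" using 1 2 by linarith
    finally show ?thesis unfolding e t_def using mult_left_mono[of _ _ "exp (s * b i j + q i j / 16)"]
      by (simp add: mult.left_commute)
  qed
  define g where "g = (\<lambda>(i, j). t i j 1 + t i j (-1))"
  let ?A = "{..<M} \<times> {..<d}"
  have "d / 16 * sum g ?A = (\<Sum>i<M. \<Sum>j<d. \<Sum>s\<in>{-1, 1}. d / 16 * t i j s)"
    by (simp add: g_def sum.cartesian_product[symmetric] sum_distrib_left algebra_simps)
  also have "\<dots> \<le> (\<Sum>i<M. \<Sum>j<d. \<Sum>s\<in>{-1, 1}. exp (conj_mat d U (W (i, s)) j j) *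
       (d * conj_mat d U (W (i, s)) j j - (\<Sum>k<d. conj_mat d U (W (i, s)) k k)
          - 2 * (\<Sum>k<d. (conj_mat d U (W (i, s)) j k)\<^sup>2)))"
    by (intro sum_mono term_le) auto
  also have "\<dots> = (\<Sum>i<M. \<Sum>s\<in>{-1, 1}. \<Sum>j<d. exp (conj_mat d U (W (i, s)) j j) *
       (d * conj_mat d U (W (i, s)) j j - (\<Sum>k<d. conj_mat d U (W (i, s)) k k)
          - 2 * (\<Sum>k<d. (conj_mat d U (W (i, s)) j k)\<^sup>2)))"
    by (intro sum.cong refl sum.swap)
  also have "\<dots> = (\<Sum>w\<in>I. \<Sum>j<d. exp (conj_mat d U (W w) j j) *
       (d * conj_mat d U (W w) j j - (\<Sum>k<d. conj_mat d U (W w) k k)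
          - 2 * (\<Sum>k<d. (conj_mat d U (W w) j k)\<^sup>2)))"
    unfolding I_def by (subst sum.cartesian_product) (simp add: split_def)
  also have "\<dots> \<le> 0" by (rule ineq)
  finally have total: "d / 16 * sum g ?A \<le> 0" .
  have "\<bar>C i j j\<bar> \<le> 16 * max 1 (ln (real M * real d)) / sqrt d" if i: "i < M" and j: "j < d" for i j
  proof -
    have d: "real d > 0" using j by simp
    have G: "sum g ?A \<le> 0" using total d by (simp add: mult_le_0_iff)
    have g3: "- 3 \<le> g w" if "w \<in> ?A" for w
      using exp_pair_bound(1)[where q = "q (fst w) (snd w)" and b = "b (fst w) (snd w)", OF q0] that
      by (simp add: g_def t_def split_def)
    \<comment> \<open>Entries below 1 are left as they are, hence the \<open>max\<close>. For a
      larger one, the total is at most 0 and each of the other pairs contributes at least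
      \<open>- 3\<close>, so \<open>exp \<bar>b i j\<bar>\<close> cannot exceed the number of
      pairs.\<close>
    have "\<bar>b i j\<bar> \<le> max 1 (ln (real M * real d))"
    proof (cases "\<bar>b i j\<bar> \<ge> 1")
      case True
      have "3 * exp \<bar>b i j\<bar> \<le> g (i, j)"
        using exp_pair_bound(2)[where q = "q i j", OF q0 True] by (simp add: g_def t_def)
      moreover have "g (i, j) - 3 * real (card ?A - 1) \<le> sum g ?A"
        using i j g3 by (intro sum_ge_single) auto
      moreover have "real (card ?A - 1) \<le> real M * real d" by (simp flip: of_nat_mult)
      ultimately have "exp \<bar>b i j\<bar> \<le> real M * real d" using G by linarith
      then have "ln (exp \<bar>b i j\<bar>) \<le> ln (real M * real d)" using exp_gt_zero order_less_le_trans ln_le_cancel_iff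
        by blast
      then show ?thesis by simp
    qed simp
    moreover have "\<bar>b i j\<bar> = sqrt d * \<bar>C i j j\<bar> / 16" using d by (simp add: b_def abs_mult)
    ultimately show ?thesis using d by (simp add: field_simps)
  qed
  then show ?thesis using U unfolding C_def by blast
qed

section \<open>Rotated bases and diagonalisation\<close>

definition rotate_family :: "nat \<Rightarrow> (nat \<Rightarrow> nat \<Rightarrow> real) \<Rightarrow> (nat \<Rightarrow> 'a \<Rightarrow> real) \<Rightarrow> nat \<Rightarrow> 'a \<Rightarrow> real" where
  "rotate_family d U e j = (\<lambda>g. \<Sum>k<d. U j k * e k g)"

lemma onb_of_rotate:
  assumes e: "onb_of X E d e" and E: "lin_subspace E" and U: "U \<in> orthogonal_matrices d"
  shows "onb_of X E d (rotate_family d U e)"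
proof -
  let ?f = "rotate_family d U e"
  have on: "orthonormal_family X d e" using e by (simp add: onb_of_def)
  have "orthonormal_family X d ?f"
    using U unfolding orthonormal_family_def rotate_family_def orthonormal_combination[OF on]
    by (simp add: orthogonal_matrices_def)
  moreover have "?f j \<in> E" for j unfolding rotate_family_def
    using e by (intro lin_subspace_sum[OF E]) (simp add: onb_of_def)
  moreover have "v g = (\<Sum>j<d. ip X v (?f j) * ?f j g)" if "v \<in> E" "g \<in> X" for v g
  proof -
    have "(\<Sum>j<d. ip X v (?f j) * ?f j g)
      = (\<Sum>j<d. (\<Sum>k<d. U j k * ip X v (e k)) * (\<Sum>k<d. U j k * e k g))"
      by (simp add: rotate_family_def ip_sum_right)
    also have "\<dots> = (\<Sum>k<d. ip X v (e k) * e k g)" by (rule orthogonal_matrices_parseval[OF U])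
    finally show ?thesis using e that by (simp add: onb_of_def)
  qed
  ultimately show ?thesis by (simp add: onb_of_def)
qed

lemma bilinear_rotate:
  assumes "\<And>c x. B (\<lambda>g. \<Sum>k<d. c k * e k g) x = (\<Sum>k<d. c k * B (e k) x)"
    and "\<And>c x. B x (\<lambda>g. \<Sum>k<d. c k * e k g) = (\<Sum>k<d. c k * B x (e k))"
  shows "B (rotate_family d U e j) (rotate_family d U e k) = conj_mat d U (\<lambda>l m. B (e l) (e m)) j k"
  by (simp add: rotate_family_def assms conj_mat_def bil_def sum_distrib_left mult.assoc)

text \<open>In any orthonormal basis of \<open>E\<close> the operator has a symmetric matrix. After
  the diagonalising rotation, \<open>A (f j)\<close> is orthogonal to every other basis vector and
  still lies in \<open>E\<close>, so only a multiple of \<open>f j\<close> is left.\<close>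

lemma spectral_basis:
  assumes X: "finite X" and E: "lin_subspace E"
    and lin: "\<And>c (u :: nat \<Rightarrow> _) J. finite J \<Longrightarrow> A (\<lambda>g. \<Sum>j\<in>J. c j * u j g) = (\<lambda>g. \<Sum>j\<in>J. c j * A (u j) g)"
    and sym: "\<And>u v. u \<in> E \<Longrightarrow> v \<in> E \<Longrightarrow> ip X (A u) v = ip X u (A v)"
    and inv: "\<And>u. u \<in> E \<Longrightarrow> A u \<in> E"
  shows "\<exists>d e lam. onb_of X E d e \<and> (\<forall>j<d. \<forall>g\<in>X. A (e j) g = lam j * e j g)"
proof -
  obtain d e where e: "onb_of X E d e" using onb_of_exists[OF X E] by blast
  define T where "T = (\<lambda>l m. ip X (A (e l)) (e m))"
  have "sym_mat d T" unfolding sym_mat_def T_def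
    using e sym by (auto simp: onb_of_def ip_commute)
  then obtain U where U: "U \<in> orthogonal_matrices d"
    and off: "\<And>j k. j < d \<Longrightarrow> k < d \<Longrightarrow> j \<noteq> k \<Longrightarrow> conj_mat d U T j k = 0"
    using spectral_sym_mat by blast
  define f where "f = rotate_family d U e"
  have f: "onb_of X E d f" unfolding f_def by (rule onb_of_rotate[OF e E U])
  have fT: "ip X (A (f j)) (f k) = conj_mat d U T j k" for j k
    unfolding f_def T_def by (rule bilinear_rotate) (simp_all add: lin ip_sum_left ip_sum_right)
  have "A (f j) g = conj_mat d U T j j * f j g" if "j < d" "g \<in> X" for j g
  proof -
    have "A (f j) \<in> E" using f that by (intro inv) (simp add: onb_of_def)
    from onb_of_expand[OF f this that(2)]
    have "A (f j) g = (\<Sum>k<d. conj_mat d U T j k * f k g)"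
      by (simp only: fT)
    also have "\<dots> = (\<Sum>k<d. if k = j then conj_mat d U T j j * f j g else 0)"
      using off that by (intro sum.cong refl) auto
    finally show ?thesis using that by simp
  qed
  with f show ?thesis
    by (intro exI[of _ d] exI[of _ f] exI[of _ "\<lambda>j. conj_mat d U T j j"]) auto
qed

section \<open>Left-invariant function spaces on a finite permutation group\<close>

locale perm_group =
  fixes X :: "('a \<Rightarrow> 'a) set"
  assumes finite_X: "finite X"
    and id_mem: "id \<in> X"
    and comp_mem: "\<And>x y. x \<in> X \<Longrightarrow> y \<in> X \<Longrightarrow> x \<circ> y \<in> X"
    and inverse: "\<And>x. x \<in> X \<Longrightarrow> bij x \<and> Hilbert_Choice.inv x \<in> X"
begin

lemma inv_comp:
  assumes "x \<in> X"
  shows "Hilbert_Choice.inv x \<circ> (x \<circ> g) = g" "x \<circ> (Hilbert_Choice.inv x \<circ> g) = g"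
    "(g \<circ> x) \<circ> Hilbert_Choice.inv x = g" "(g \<circ> Hilbert_Choice.inv x) \<circ> x = g"
  using inverse[OF assms] by (auto simp: fun_eq_iff bij_is_inj bij_is_surj surj_f_inv_f)

lemma left_mult_bij: "x \<in> X \<Longrightarrow> bij_betw (\<lambda>g. x \<circ> g) X X"
  by (intro bij_betwI[where g = "\<lambda>g. Hilbert_Choice.inv x \<circ> g"]) (auto simp: inv_comp comp_mem inverse)

lemma right_mult_bij: "x \<in> X \<Longrightarrow> bij_betw (\<lambda>g. g \<circ> x) X X"
  by (intro bij_betwI[where g = "\<lambda>g. g \<circ> Hilbert_Choice.inv x"]) (auto simp: inv_comp comp_mem inverse)

lemma sum_left_mult: "x \<in> X \<Longrightarrow> (\<Sum>g\<in>X. f (x \<circ> g)) = (\<Sum>g\<in>X. f g)"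
  using sum.reindex_bij_betw[OF left_mult_bij] .

lemma sum_right_mult: "x \<in> X \<Longrightarrow> (\<Sum>g\<in>X. f (g \<circ> x)) = (\<Sum>g\<in>X. f g)"
  using sum.reindex_bij_betw[OF right_mult_bij] .

lemma ip_left_mult: "x \<in> X \<Longrightarrow> ip X (\<lambda>g. u (x \<circ> g)) (\<lambda>g. v (x \<circ> g)) = ip X u v"
  unfolding ip_def by (rule sum_left_mult)

text \<open>
  The sum is the squared norm of the vector in \<open>E\<close> that represents evaluation at \<open>g\<close>.
\<close>

lemma left_invariant_kernel_diagonal:
  assumes e: "onb_of X E d e" and E: "lin_subspace E"
    and inv: "\<And>x v. x \<in> X \<Longrightarrow> v \<in> E \<Longrightarrow> (\<lambda>g. v (x \<circ> g)) \<in> E" and g: "g \<in> X"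
  shows "(\<Sum>j<d. (e j g)\<^sup>2) = d / card X"
proof -
  have on: "orthonormal_family X d e" using e by (simp add: onb_of_def)
  define P where "P = (\<lambda>g. \<Sum>j<d. (e j g)\<^sup>2)"
  \<comment> \<open>The translate \<open>v\<close> of the representing vector \<open>p g\<close> has
    squared norm \<open>P g\<close> and takes the value \<open>P g\<close> at
    \<open>x \<circ> g\<close>. Expanding the squared norm of \<open>v - p (x \<circ> g)\<close>
    gives \<open>P (x \<circ> g) - P g \<ge> 0\<close>. Left multiplication is transitive, so this
    inequality alone makes \<open>P\<close> constant.\<close>
  have mono: "P g \<le> P (x \<circ> g)" if x: "x \<in> X" and g: "g \<in> X" for x g
  proof -
    define p where "p = (\<lambda>g h. \<Sum>j<d. e j g * e j h)"
    have pE: "p g \<in> E" for g unfolding p_def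
      using e by (intro lin_subspace_sum[OF E]) (simp add: onb_of_def)
    have rep: "ip X v (p g) = v g" if "v \<in> E" "g \<in> X" for v g
    proof -
      have "ip X v (p g) = (\<Sum>j<d. e j g * ip X v (e j))" unfolding p_def by (rule ip_sum_right)
      then show ?thesis using e that by (simp add: onb_of_def mult.commute)
    qed
    have pp: "ip X (p g) (p g) = P g" for g
      unfolding p_def P_def orthonormal_combination[OF on] by (simp add: power2_eq_square)
    define v where "v = (\<lambda>h. p g (Hilbert_Choice.inv x \<circ> h))"
    have ix: "Hilbert_Choice.inv x \<in> X" using inverse[OF x] by simp
    have v: "v \<in> E" unfolding v_def by (rule inv[OF ix pE])
    have "ip X v v = P g" unfolding v_def ip_left_mult[OF ix] by (rule pp)
    moreover have "v (x \<circ> g) = P g" by (simp add: v_def inv_comp[OF x] p_def P_def power2_eq_square)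
    ultimately have "0 \<le> P g - 2 * P g + P (x \<circ> g)"
      using ip_self_nonneg[of X "\<lambda>h. v h - p (x \<circ> g) h"] rep[OF v comp_mem[OF x g]] pp
      by (simp add: ip_diff_left ip_diff_right ip_commute[of X "p (x \<circ> g)" v])
    then show ?thesis by simp
  qed
  have eq: "P h = P g" if h: "h \<in> X" for h
  proof -
    have "P g \<le> P ((h \<circ> Hilbert_Choice.inv g) \<circ> g)" "P h \<le> P ((g \<circ> Hilbert_Choice.inv h) \<circ> h)"
      using g h inverse by (auto intro!: mono comp_mem)
    then show ?thesis using g h by (simp add: inv_comp)
  qed
  have "card X * P g = (\<Sum>h\<in>X. P h)" by (simp add: eq)
  also have "\<dots> = (\<Sum>j<d. ip X (e j) (e j))"
    unfolding P_def ip_def by (subst sum.swap) (simp add: power2_eq_square)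
  also have "\<dots> = d" using on by (simp add: orthonormal_familyD)
  finally have "card X * P g = d" .
  moreover have "card X \<noteq> 0" using g finite_X by auto
  ultimately show ?thesis by (simp add: P_def eq_divide_eq mult.commute)
qed

lemma balanced_basis:
  fixes F :: "nat \<Rightarrow> ('a \<Rightarrow> 'a) \<Rightarrow> real"
  assumes E: "lin_subspace E"
    and inv: "\<And>x v. x \<in> X \<Longrightarrow> v \<in> E \<Longrightarrow> (\<lambda>g. v (x \<circ> g)) \<in> E"
  shows "\<exists>d e. onb_of X E d e \<and> (\<forall>i<M. \<forall>j<d.
    \<bar>(\<Sum>g\<in>X. F i g * (e j g)\<^sup>2) - (\<Sum>g\<in>X. F i g) / card X\<bar>
      \<le> 16 * max 1 (ln (real M * real d)) / sqrt d * (sqrt (\<Sum>g\<in>X. (F i g)\<^sup>2) / sqrt (card X)))"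
proof -
  obtain d e where e: "onb_of X E d e" using onb_of_exists[OF finite_X E] by blast
  have on: "orthonormal_family X d e" using e by (simp add: onb_of_def)
  have N: "real (card X) > 0" using finite_X id_mem by (auto simp: card_gt_0_iff)
  define m where "m = (\<lambda>i. (\<Sum>g\<in>X. F i g) / card X)"
  define f where "f = (\<lambda>i g. F i g - m i)"
  define \<tau> where "\<tau> = (\<lambda>i. sqrt (\<Sum>g\<in>X. (F i g)\<^sup>2) / sqrt (card X))"
  have \<tau>0: "\<tau> i \<ge> 0" for i by (simp add: \<tau>_def sum_nonneg)
  define B where "B = (\<lambda>i u v. \<Sum>g\<in>X. f i g / \<tau> i * (u g * v g))"
  define T where "T = (\<lambda>i l m. B i (e l) (e m))"
  note diag = left_invariant_kernel_diagonal[OF e E inv]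
  have f0: "(\<Sum>g\<in>X. f i g) = 0" for i using N by (simp add: f_def sum_subtractf m_def)
  have f2: "(\<Sum>g\<in>X. (f i g)\<^sup>2) \<le> (\<Sum>g\<in>X. (F i g)\<^sup>2)" for i
  proof -
    have "(\<Sum>g\<in>X. (F i g)\<^sup>2) = (\<Sum>g\<in>X. (f i g)\<^sup>2 + 2 * m i * f i g + (m i)\<^sup>2)"
      by (intro sum.cong refl) (simp add: f_def power2_eq_square algebra_simps)
    also have "\<dots> = (\<Sum>g\<in>X. (f i g)\<^sup>2) + card X * (m i)\<^sup>2"
      by (simp add: sum.distrib f0 flip: sum_distrib_left)
    finally show ?thesis by simp
  qed
  have 1: "sym_mat d (T i)" for i unfolding sym_mat_def T_def B_def by (simp add: mult.commute)
  have 2: "(\<Sum>j<d. T i j j) = 0" for i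
  proof -
    have "(\<Sum>j<d. T i j j) = (\<Sum>g\<in>X. f i g / \<tau> i * (\<Sum>j<d. (e j g)\<^sup>2))"
      unfolding T_def B_def by (subst sum.swap) (simp add: sum_distrib_left power2_eq_square)
    also have "\<dots> = (\<Sum>g\<in>X. f i g / \<tau> i * (d / card X))" by (simp add: diag)
    also have "\<dots> = (\<Sum>g\<in>X. f i g) * (d / card X / \<tau> i)"
      unfolding sum_distrib_right by (intro sum.cong refl) simp
    finally show ?thesis by (simp add: f0)
  qed
  \<comment> \<open>Bessel in the index \<open>k\<close> removes the second basis vector. The sum
    over \<open>j\<close> then meets the constant kernel diagonal, which yields the factor
    \<open>d / card X\<close> that the normalisation by \<open>\<tau> i\<close> cancels.\<close>
  have 3: "(\<Sum>j<d. \<Sum>k<d. (T i j k)\<^sup>2) \<le> d" for i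
  proof -
    have "(\<Sum>j<d. \<Sum>k<d. (T i j k)\<^sup>2) \<le> (\<Sum>j<d. ip X (\<lambda>g. f i g / \<tau> i * e j g) (\<lambda>g. f i g / \<tau> i * e j g))"
    proof (rule sum_mono)
      fix j
      have "T i j k = ip X (\<lambda>g. f i g / \<tau> i * e j g) (e k)" for k
        by (simp add: T_def B_def ip_def mult.assoc)
      then show "(\<Sum>k<d. (T i j k)\<^sup>2) \<le> ip X (\<lambda>g. f i g / \<tau> i * e j g) (\<lambda>g. f i g / \<tau> i * e j g)"
        using bessel[OF on] by simp
    qed
    also have "\<dots> = (\<Sum>g\<in>X. (f i g / \<tau> i)\<^sup>2 * (\<Sum>j<d. (e j g)\<^sup>2))"
      unfolding ip_def by (subst sum.swap) (simp add: sum_distrib_left sum_divide_distrib power2_eq_square mult_ac)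
    also have "\<dots> = (\<Sum>g\<in>X. (f i g / \<tau> i)\<^sup>2 * (d / card X))" by (simp add: diag)
    also have "\<dots> = (\<Sum>g\<in>X. (f i g)\<^sup>2) * (d / card X / (\<tau> i)\<^sup>2)"
      unfolding sum_distrib_right by (intro sum.cong refl) (simp add: power_divide)
    also have "\<dots> \<le> (\<Sum>g\<in>X. (F i g)\<^sup>2) * (d / card X / (\<tau> i)\<^sup>2)"
      by (intro mult_right_mono f2) simp
    also have "\<dots> \<le> d"
    proof (cases "(\<Sum>g\<in>X. (F i g)\<^sup>2) = 0")
      case False
      have "(\<tau> i)\<^sup>2 = (\<Sum>g\<in>X. (F i g)\<^sup>2) / card X"
        by (simp add: \<tau>_def power_divide sum_nonneg)
      then show ?thesis using False N by simp
    qed simp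
    finally show ?thesis .
  qed
  obtain U where U: "U \<in> orthogonal_matrices d" and bound:
    "\<And>i j. i < M \<Longrightarrow> j < d \<Longrightarrow> \<bar>conj_mat d U (T i) j j\<bar> \<le> 16 * max 1 (ln (real M * real d)) / sqrt d"
    using exists_balancing_rotation[of M d T] 1 2 3 by blast
  define h where "h = rotate_family d U e"
  have h: "onb_of X E d h" unfolding h_def by (rule onb_of_rotate[OF e E U])
  have Bsum: "B i (\<lambda>g. \<Sum>k<d. c k * e k g) x = (\<Sum>k<d. c k * B i (e k) x)"
    "B i x (\<lambda>g. \<Sum>k<d. c k * e k g) = (\<Sum>k<d. c k * B i x (e k))" for i c x
  proof -
    show "B i (\<lambda>g. \<Sum>k<d. c k * e k g) x = (\<Sum>k<d. c k * B i (e k) x)"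
      using ip_sum_left[of X c e "{..<d}" "\<lambda>g. f i g / \<tau> i * x g"]
      by (simp add: B_def ip_def mult_ac)
    then show "B i x (\<lambda>g. \<Sum>k<d. c k * e k g) = (\<Sum>k<d. c k * B i x (e k))"
      by (simp add: B_def mult_ac)
  qed
  have "\<bar>(\<Sum>g\<in>X. F i g * (h j g)\<^sup>2) - m i\<bar> \<le> 16 * max 1 (ln (real M * real d)) / sqrt d * \<tau> i"
    if ij: "i < M" "j < d" for i j
  proof -
    have "ip X (h j) (h j) = 1" using h ij orthonormal_familyD[of X d h j j] by (simp add: onb_of_def)
    then have "(\<Sum>g\<in>X. f i g * (h j g)\<^sup>2) = (\<Sum>g\<in>X. F i g * (h j g)\<^sup>2) - m i"
      by (simp add: f_def ip_def left_diff_distrib sum_subtractf power2_eq_square flip: sum_distrib_left)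
    \<comment> \<open>Nothing is lost in dividing by \<open>\<tau> i\<close>: if it is 0, then
      \<open>F i\<close>, and with it \<open>f i\<close>, vanishes on \<open>X\<close>.\<close>
    moreover have "(\<Sum>g\<in>X. f i g * (h j g)\<^sup>2) = B i (h j) (h j) * \<tau> i"
    proof (cases "\<tau> i = 0")
      case True
      then have "(\<Sum>g\<in>X. (F i g)\<^sup>2) = 0" using N by (simp add: \<tau>_def)
      then have "(\<Sum>g\<in>X. (f i g)\<^sup>2) = 0" using f2[of i] by (simp add: sum_nonneg antisym)
      then have "\<forall>g\<in>X. f i g = 0" using finite_X by (simp add: sum_nonneg_eq_0_iff)
      then show ?thesis using True by simp
    next
      case False
      then show ?thesis by (simp add: B_def sum_distrib_right power2_eq_square)
    qed
    moreover have "B i (h j) (h j) = conj_mat d U (T i) j j"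
      unfolding h_def T_def by (rule bilinear_rotate) (simp_all add: Bsum)
    ultimately have "\<bar>(\<Sum>g\<in>X. F i g * (h j g)\<^sup>2) - m i\<bar> = \<bar>conj_mat d U (T i) j j\<bar> * \<tau> i"
      using \<tau>0[of i] by (metis abs_mult abs_of_nonneg)
    then show ?thesis using mult_right_mono[OF bound[OF ij] \<tau>0[of i]] by (simp only:)
  qed
  then show ?thesis using h unfolding m_def \<tau>_def by blast
qed

end

section \<open>Dimension of nontrivial representations of the alternating group\<close>

definition even_perms :: "'a set \<Rightarrow> ('a \<Rightarrow> 'a) set" where
  "even_perms A = {p. p permutes A \<and> evenperm p}"

definition double_transposition :: "'a \<Rightarrow> 'a \<Rightarrow> 'a \<Rightarrow> 'a \<Rightarrow> 'a \<Rightarrow> 'a" where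
  "double_transposition a b c d = transpose a b \<circ> transpose c d"

lemma even_perms_permutation: "finite A \<Longrightarrow> p permutes A \<Longrightarrow> permutation p"
  by (auto simp: permutation_permutes)

lemma double_transposition_even:
  assumes "finite A" "{a, b, c, d} \<subseteq> A" "a \<noteq> b" "c \<noteq> d"
  shows "double_transposition a b c d \<in> even_perms A"
  using assms unfolding even_perms_def double_transposition_def
  by (auto simp: permutes_compose permutes_swap_id evenperm_comp evenperm_swap permutation_swap_id)

lemma inj_transpose_comp:
  assumes "inj f"
  shows "f \<circ> transpose a b = transpose (f a) (f b) \<circ> f"
  using assms by (auto simp: fun_eq_iff transpose_def inj_eq)

lemma inj_double_transposition:
  assumes "inj f"
  shows "f \<circ> double_transposition a b c d = double_transposition (f a) (f b) (f c) (f d) \<circ> f"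
proof -
  have "f \<circ> double_transposition a b c d = (f \<circ> transpose a b) \<circ> transpose c d"
    by (simp add: double_transposition_def comp_assoc)
  also have "\<dots> = transpose (f a) (f b) \<circ> (f \<circ> transpose c d)"
    by (simp add: inj_transpose_comp[OF assms] comp_assoc)
  also have "\<dots> = double_transposition (f a) (f b) (f c) (f d) \<circ> f"
    by (simp add: inj_transpose_comp[OF assms] double_transposition_def comp_assoc)
  finally show ?thesis .
qed

text \<open>A permutation that is right on the tail is corrected at the head by a transposition of
  \<open>p x\<close> and \<open>y\<close>. Both points lie outside the targets already reached, so
  these stay fixed.\<close>

lemma permutes_list_extension:
  assumes "length xs = length ys" "distinct xs" "distinct ys" "set xs \<subseteq> A" "set ys \<subseteq> A"
  shows "\<exists>p. p permutes A \<and> map p xs = ys"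
  using assms
proof (induction xs ys rule: list_induct2)
  case Nil
  show ?case by (intro exI[of _ id] conjI permutes_id) simp
next
  case (Cons x xs y ys)
  then obtain p where p: "p permutes A" "map p xs = ys" by auto
  have px: "p x \<notin> set ys" using p Cons.prems by (auto dest: permutes_inj[THEN injD])
  have "transpose (p x) y \<circ> p permutes A"
    using p Cons.prems permutes_in_image[OF p(1), of x]
    by (intro permutes_compose permutes_swap_id) auto
  moreover have "map (transpose (p x) y \<circ> p) (x # xs) = y # ys"
  proof -
    have "transpose (p x) y (p z) = p z" if "z \<in> set xs" for z
    proof -
      have "p z \<in> set ys" using p(2) that by auto
      then show ?thesis using px Cons.prems by (intro transpose_apply_other) auto
    qed
    then have "map (transpose (p x) y \<circ> p) xs = map p xs" by (intro map_cong refl) (simp only: o_apply)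
    then show ?thesis by (simp only: list.map o_apply transpose_apply_first p(2))
  qed
  ultimately show ?case by (intro exI conjI)
qed

text \<open>Some permutation carries the first four points to the others. If it is odd, composing it
  with the transposition of \<open>a\<close> and \<open>b\<close> makes it even, and that
  transposition commutes with the double transposition.\<close>

lemma double_transpositions_conjugate:
  assumes A: "finite A" and x: "distinct [a, b, c, d]" "{a, b, c, d} \<subseteq> A"
    and y: "distinct [a', b', c', d']" "{a', b', c', d'} \<subseteq> A"
  shows "\<exists>x\<in>even_perms A. x \<circ> double_transposition a b c d = double_transposition a' b' c' d' \<circ> x"
proof -
  obtain p where p: "p permutes A" "map p [a, b, c, d] = [a', b', c', d']"
    using permutes_list_extension[of "[a, b, c, d]" "[a', b', c', d']" A] x y by auto
  let ?q = "p \<circ> transpose a b"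
  have "transpose a b c = c" "transpose a b d = d" using x by (auto intro!: transpose_apply_other)
  note cd = this
  have q: "?q permutes A" using p x by (intro permutes_compose permutes_swap_id) auto
  have "evenperm p \<or> evenperm ?q"
    using p x A by (auto simp: evenperm_comp evenperm_swap permutation_swap_id even_perms_permutation)
  moreover have "p \<circ> double_transposition a b c d = double_transposition a' b' c' d' \<circ> p"
    using p inj_double_transposition[OF permutes_inj[OF p(1)], of a b c d] by simp
  moreover have "?q \<circ> double_transposition a b c d = double_transposition a' b' c' d' \<circ> ?q"
    using p x inj_double_transposition[OF permutes_inj[OF q], of a b c d]
    by (simp add: double_transposition_def transpose_commute[of a' b'] cd)
  ultimately show ?thesis using p q unfolding even_perms_def by blast
qed

section \<open>Scalar actions by left translation\<close>

definition acts_by :: "(('a \<Rightarrow> 'a) \<Rightarrow> real) set \<Rightarrow> ('a \<Rightarrow> 'a) \<Rightarrow> real \<Rightarrow> bool" where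
  "acts_by E t \<epsilon> \<longleftrightarrow> (\<forall>v\<in>E. \<forall>g. v (t \<circ> g) = \<epsilon> * v g)"

definition left_invariant :: "('a \<Rightarrow> 'a) set \<Rightarrow> (('a \<Rightarrow> 'a) \<Rightarrow> real) set \<Rightarrow> bool" where
  "left_invariant K E \<longleftrightarrow> (\<forall>x\<in>K. \<forall>v\<in>E. (\<lambda>g. v (x \<circ> g)) \<in> E)"

lemma acts_by_comp:
  assumes "acts_by E s a" "acts_by E t b"
  shows "acts_by E (s \<circ> t) (a * b)"
  using assms by (simp add: acts_by_def comp_assoc mult.assoc)

text \<open>The scalar action of \<open>s\<close> is applied to the translate
  \<open>\<lambda>g. v (x \<circ> g)\<close>, which lies in \<open>E\<close> by left invariance, at
  the point \<open>inv x \<circ> g\<close>.\<close>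

lemma acts_by_conjugate:
  assumes inv: "left_invariant K E" and x: "x \<in> K" "bij x" "x \<circ> s = t \<circ> x" and s: "acts_by E s \<epsilon>"
  shows "acts_by E t \<epsilon>"
  unfolding acts_by_def
proof (intro ballI allI)
  fix v and g :: "'a \<Rightarrow> 'a" assume v: "v \<in> E"
  define h where "h = Hilbert_Choice.inv x \<circ> g"
  have g: "g = x \<circ> h" using x(2) by (simp add: h_def fun_eq_iff bij_is_surj surj_f_inv_f)
  have w: "(\<lambda>g :: 'a \<Rightarrow> 'a. v (x \<circ> g)) \<in> E" using inv x(1) v by (simp add: left_invariant_def)
  have "v (t \<circ> g) = v (x \<circ> (s \<circ> h))" using x(3) by (simp add: g flip: comp_assoc)
  also have "\<dots> = \<epsilon> * v (x \<circ> h)" using s w unfolding acts_by_def by fast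
  finally show "v (t \<circ> g) = \<epsilon> * v g" by (simp add: g)
qed

lemma acts_by_double_transposition:
  assumes A: "finite A" and inv: "left_invariant (even_perms A) E"
    and x: "distinct [a, b, c, d]" "{a, b, c, d} \<subseteq> A"
    and y: "distinct [a', b', c', d']" "{a', b', c', d'} \<subseteq> A"
    and t: "acts_by E (double_transposition a b c d) \<epsilon>"
  shows "acts_by E (double_transposition a' b' c' d') \<epsilon>"
proof -
  obtain x where "x \<in> even_perms A" "x \<circ> double_transposition a b c d = double_transposition a' b' c' d' \<circ> x"
    using double_transpositions_conjugate[OF A x y] by blast
  then show ?thesis using acts_by_conjugate[OF inv _ _ _ t] by (auto simp: even_perms_def permutes_bij)
qed

lemma swapidseq_ext_SucE:
  assumes "swapidseq_ext A (Suc n) p"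
  obtains a b p' where "a \<in> A" "b \<in> A" "a \<noteq> b" "swapidseq_ext A n p'" "p = transpose a b \<circ> p'"
  using swapidseq_ext_backwards'[OF assms] by auto

text \<open>By conjugation all double transpositions act trivially, and every even permutation is a
  product of pairs of transpositions. If the two transpositions of a pair share a point, they cover
  at most three points; five points leave room for a disjoint transposition, whose insertion twice
  turns the pair into two double transpositions.\<close>

lemma double_transposition_acts_trivially:
  assumes A: "finite A" "card A \<ge> 5" and inv: "left_invariant (even_perms A) E"
    and x: "distinct [a, b, c, d]" "{a, b, c, d} \<subseteq> A"
    and t: "acts_by E (double_transposition a b c d) 1" and p: "p \<in> even_perms A"
  shows "acts_by E p 1"
proof -
  have disj: "acts_by E (double_transposition q r s u) 1"
    if "distinct [q, r, s, u]" "{q, r, s, u} \<subseteq> A" for q r s u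
    using acts_by_double_transposition[OF A(1) inv x that t] .
  have pair: "acts_by E (transpose q r \<circ> transpose s u) 1"
    if qr: "q \<noteq> r" "s \<noteq> u" "{q, r, s, u} \<subseteq> A" for q r s u
  proof (cases "distinct [q, r, s, u]")
    case True
    then show ?thesis using disj[OF True] that by (simp add: double_transposition_def)
  next
    case False
    then have "card {q, r, s, u} \<le> 3" using qr by (auto simp: card_insert_if)
    then have "card (A - {q, r, s, u}) \<ge> 2"
      using A qr(3) by (subst card_Diff_subset) auto
    then obtain y z where yz: "y \<noteq> z" "y \<in> A - {q, r, s, u}" "z \<in> A - {q, r, s, u}"
      by (metis One_nat_def card_le_Suc0_iff_eq A(1) finite_Diff not_less_eq_eq numeral_2_eq_2)
    have "acts_by E (double_transposition q r y z \<circ> double_transposition y z s u) (1 * 1)"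
      using yz qr by (intro acts_by_comp disj) auto
    moreover have "double_transposition q r y z \<circ> double_transposition y z s u = transpose q r \<circ> transpose s u"
      by (simp add: double_transposition_def fun_eq_iff)
    ultimately show ?thesis by simp
  qed
  have "acts_by E p 1" if "swapidseq_ext A n p" "even n" for n p
    using that
  proof (induction n arbitrary: p rule: less_induct)
    case (less n)
    show ?case
    proof (cases "n = 0")
      case True
      then have "p = id" using less.prems swapidseq_ext_zero_imp_id[of A p] by simp
      then show ?thesis by (simp add: acts_by_def comp_def)
    next
      case False
      then obtain k where k: "n = Suc k" using not0_implies_Suc by blast
      with less.prems(2) obtain m where n: "n = Suc (Suc m)" by (cases k) auto
      have "swapidseq_ext A (Suc (Suc m)) p" using less.prems(1) n by simp
      from swapidseq_ext_SucE[OF this] obtain q r p' where 1: "q \<in> A" "r \<in> A" "q \<noteq> r" "swapidseq_ext A (Suc m) p'" "p = transpose q r \<circ> p'"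
        by metis
      from swapidseq_ext_SucE[OF 1(4)] obtain s u p'' where 2: "s \<in> A" "u \<in> A" "s \<noteq> u" "swapidseq_ext A m p''" "p' = transpose s u \<circ> p''"
        by metis
      have "acts_by E ((transpose q r \<circ> transpose s u) \<circ> p'') (1 * 1)"
        using 1 2 n less.prems by (intro acts_by_comp pair less.IH[of m]) auto
      then show ?thesis by (simp only: 1(5) 2(5) comp_assoc mult_1)
    qed
  qed
  moreover obtain n where n: "swapidseq_ext A n p"
    using swapidseq_ext_of_permutation[of p A] p A by (auto simp: even_perms_def)
  moreover have "even n"
    using p evenperm_unique[OF swapidseq_ext_imp_swapidseq[OF n] refl] by (simp add: even_perms_def)
  ultimately show ?thesis by blast
qed

text \<open>
  The product of two of the three double transpositions on four points is the third one, and all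
  three are conjugate.
\<close>

lemma double_transposition_not_minus_one:
  assumes A: "finite A" and inv: "left_invariant (even_perms A) E"
    and x: "distinct [a, b, c, d]" "{a, b, c, d} \<subseteq> A"
    and t: "acts_by E (double_transposition a b c d) (- 1)"
  shows "v \<in> E \<Longrightarrow> v g = 0"
proof -
  assume v: "v \<in> E"
  have "acts_by E (double_transposition a c b d) (- 1)" "acts_by E (double_transposition a d b c) (- 1)"
    using x by (auto intro!: acts_by_double_transposition[OF A inv x _ _ t])
  moreover from this have "acts_by E (double_transposition a b c d \<circ> double_transposition a c b d) (- 1 * - 1)"
    using t by (intro acts_by_comp)
  moreover have "double_transposition a b c d \<circ> double_transposition a c b d = double_transposition a d b c"
    using x by (auto simp: double_transposition_def fun_eq_iff transpose_def)
  ultimately have "v (double_transposition a d b c \<circ> g) = v g" "v (double_transposition a d b c \<circ> g) = - v g"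
    using v by (auto simp: acts_by_def)
  then show ?thesis by simp
qed

context perm_group
begin

text \<open>
  Removing the four points moved by a double transposition \<open>t\<close>, both eigenspaces of \<open>t\<close> in
  \<open>E\<close> are nonzero, and the smaller group acts nontrivially on one of them. The induction
  hypothesis applies to that one, and the other contributes at least one more dimension.
\<close>

lemma even_perms_representation_dim:
  assumes "finite A" "even_perms A \<subseteq> X" "lin_subspace E" "left_invariant (even_perms A) E"
    and "\<And>v g. v \<in> E \<Longrightarrow> g \<notin> X \<Longrightarrow> v g = 0"
    and "x \<in> even_perms A" "\<not> acts_by E x 1"
  shows "\<exists>e. orthonormal_family X (card A div 4) e \<and> (\<forall>j<card A div 4. e j \<in> E)"
  using assms
proof (induction "card A" arbitrary: A E x rule: less_induct)
  case less
  note A = less.prems(1) and AX = less.prems(2) and E = less.prems(3) and inv = less.prems(4)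
    and supp = less.prems(5)
  have nonzero: "ip X w w \<noteq> 0" if "w \<in> E" "w g \<noteq> 0" for w g
    using that supp[of w g] by (auto simp: ip_self_eq_0_iff[OF finite_X])
  \<comment> \<open>Below eight points the claimed dimension is 0 or 1, and one nonzero vector is
    enough. From eight points on, removing four leaves at least four, enough for another double
    transposition.\<close>
  consider "card A < 4" | "4 \<le> card A" "card A < 8" | "8 \<le> card A" by linarith
  then show ?case
  proof cases
    case 1
    then show ?thesis by (simp add: orthonormal_family_def)
  next
    case 2
    obtain v g where v: "v \<in> E" "v (x \<circ> g) \<noteq> v g" using less.prems(7) by (auto simp: acts_by_def)
    then have "v (x \<circ> g) \<noteq> 0 \<or> v g \<noteq> 0" by auto
    then have "ip X v v \<noteq> 0" using nonzero v(1) by blast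
    then have "\<exists>e. orthonormal_family X (Suc 0) e \<and> (\<forall>j<Suc 0. e j \<in> E)"
      by (intro orthonormal_family_extend[OF finite_X _ v(1) E]) (auto simp: orthonormal_family_def)
    moreover have "card A div 4 = Suc 0" using 2 by simp
    ultimately show ?thesis by simp
  next
    case 3
    obtain D where D: "D \<subseteq> A" "card D = 4" using obtain_subset_with_card_n[of 4 A] 3 by auto
    obtain xs where xs: "set xs = D" "distinct xs" using finite_distinct_list[of D] D A finite_subset by blast
    then have "length xs = 4" using D distinct_card by metis
    then obtain a b c d where "xs = [a, b, c, d]"
      by (auto simp: numeral_eq_Suc length_Suc_conv)
    then have abcd: "distinct [a, b, c, d]" "{a, b, c, d} \<subseteq> A" and Dabcd: "D = {a, b, c, d}"
      using xs D by auto
    define t where "t = double_transposition a b c d"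
    define A' where "A' = A - {a, b, c, d}"
    have A': "finite A'" "A' \<subseteq> A" and cardA': "card A' = card A - 4"
      using A D finite_subset[OF D(1)] by (auto simp: A'_def card_Diff_subset Dabcd[symmetric])
    have t: "t \<in> even_perms A" unfolding t_def using A abcd by (intro double_transposition_even) auto
    have tt: "t \<circ> (t \<circ> g) = g" for g
      using abcd by (auto simp: t_def double_transposition_def fun_eq_iff transpose_def)
    have sub: "even_perms A' \<subseteq> even_perms A" using A' by (auto simp: even_perms_def intro: permutes_subset)
    have commute: "y \<circ> (t \<circ> g) = t \<circ> (y \<circ> g)" if "y \<in> even_perms A'" for y g
    proof -
      have "y permutes A'" using that by (simp add: even_perms_def)
      then have "y a = a" "y b = b" "y c = c" "y d = d" "inj y"
        by (auto simp: A'_def permutes_not_in permutes_inj)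
      then have "y \<circ> t = t \<circ> y" unfolding t_def by (simp add: inj_double_transposition)
      then show ?thesis by (simp flip: comp_assoc)
    qed
    define Es where "Es = (\<lambda>s. {v \<in> E. \<forall>g. v (t \<circ> g) = s * v g})"
    have EsE: "Es s \<subseteq> E" for s by (auto simp: Es_def)
    have linEs: "lin_subspace (Es s)" for s
      using E unfolding lin_subspace_def Es_def by (auto simp: algebra_simps)
    have invEs: "left_invariant (even_perms A') (Es s)" for s
      unfolding left_invariant_def
    proof (intro ballI)
      fix y v assume y: "y \<in> even_perms A'" and v: "v \<in> Es s"
      have "v (y \<circ> (t \<circ> g)) = s * v (y \<circ> g)" for g
        unfolding commute[OF y] using v by (simp add: Es_def)
      moreover have "(\<lambda>g. v (y \<circ> g)) \<in> E"
        using inv sub y v by (auto simp: left_invariant_def Es_def)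
      ultimately show "(\<lambda>g. v (y \<circ> g)) \<in> Es s" by (simp add: Es_def)
    qed
    have split: "(\<lambda>g. v g + s * v (t \<circ> g)) \<in> Es s" if v: "v \<in> E" and s: "s * s = 1" for v s
    proof -
      have "(\<lambda>g. v (t \<circ> g)) \<in> E" using inv t v by (simp add: left_invariant_def)
      then have "(\<lambda>g. v g + s * v (t \<circ> g)) \<in> E"
        by (intro lin_subspace_add[OF E v] lin_subspace_scale[OF E])
      then show ?thesis using s by (simp add: Es_def tt algebra_simps flip: mult.assoc)
    qed
    have orth: "ip X v w = 0" if "v \<in> Es s" "w \<in> Es (- s)" "s * s = 1" for v w s
    proof -
      have "ip X v w = ip X (\<lambda>g. v (t \<circ> g)) (\<lambda>g. w (t \<circ> g))"
        using ip_left_mult t AX by auto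
      also have "\<dots> = ip X (\<lambda>g. s * v g) (\<lambda>g. - s * w g)"
        using that by (simp add: Es_def)
      also have "\<dots> = - (s * s) * ip X v w" unfolding ip_scale_left ip_scale_right by simp
      finally show ?thesis using that by simp
    qed
    \<comment> \<open>If \<open>t\<close> acted as 1, its conjugates would generate a trivial action
      of all even permutations; if it acted as \<open>- 1\<close>, the space would be zero. Neither
      is possible, so some \<open>v - s * v(t \<circ> g)\<close> is nonzero, and it lies in the
      eigenspace for \<open>- s\<close>.\<close>
    have nontriv: "\<exists>w\<in>Es (- s). ip X w w \<noteq> 0" if s: "s = 1 \<or> s = - 1" for s
    proof -
      have "\<not> acts_by E t s"
      proof
        assume a: "acts_by E t s"
        show False
        proof (cases "s = 1")
          case True
          then show False using less.prems(6,7) a 3 double_transposition_acts_trivially[OF A _ inv abcd, of x]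
            by (simp add: t_def)
        next
          case False
          then have "v g = 0" if "v \<in> E" for v g
            using double_transposition_not_minus_one[OF A inv abcd] a s that by (simp add: t_def)
          then show False using less.prems(7) unfolding acts_by_def by (metis mult_zero_right)
        qed
      qed
      then obtain v g where v: "v \<in> E" "v (t \<circ> g) \<noteq> s * v g" by (auto simp: acts_by_def)
      let ?w = "\<lambda>g. v g + (- s) * v (t \<circ> g)"
      have w: "?w \<in> Es (- s)" using s by (intro split v) auto
      moreover have "?w g \<noteq> 0" using v(2) s by auto
      ultimately show ?thesis using nonzero EsE by blast
    qed
    \<comment> \<open>Otherwise the even permutations of \<open>A'\<close> fix the components of
      each \<open>v\<close> in both eigenspaces and hence \<open>v\<close> itself. A double
      transposition supported in \<open>A'\<close> then acts trivially, and with it all even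
      permutations of \<open>A\<close>.\<close>
    have "\<exists>s y. (s = 1 \<or> s = - 1) \<and> y \<in> even_perms A' \<and> \<not> acts_by (Es s) y 1"
    proof (rule ccontr)
      assume "\<not> ?thesis"
      then have triv: "acts_by (Es 1) y 1" "acts_by (Es (- 1)) y 1" if "y \<in> even_perms A'" for y
        using that by auto
      have all: "acts_by E y 1" if y: "y \<in> even_perms A'" for y
        unfolding acts_by_def
      proof (intro ballI allI)
        fix v g assume v: "v \<in> E"
        have "v (y \<circ> g) + 1 * v (t \<circ> (y \<circ> g)) = 1 * (v g + 1 * v (t \<circ> g))"
          using triv(1)[OF y] split[OF v, of 1] unfolding acts_by_def by fastforce
        moreover have "v (y \<circ> g) + - 1 * v (t \<circ> (y \<circ> g)) = 1 * (v g + - 1 * v (t \<circ> g))"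
          using triv(2)[OF y] split[OF v, of "- 1"] unfolding acts_by_def by fastforce
        ultimately show "v (y \<circ> g) = 1 * v g" by simp
      qed
      have "4 \<le> card A'" using cardA' 3 by simp
      then obtain D' where D': "D' \<subseteq> A'" "card D' = 4" using obtain_subset_with_card_n by metis
      obtain ys where ys: "set ys = D'" "distinct ys" using finite_distinct_list[of D'] D' A' finite_subset by blast
      then have "length ys = 4" using D' distinct_card by metis
      then obtain p q r u where "ys = [p, q, r, u]"
        by (auto simp: numeral_eq_Suc length_Suc_conv)
      then have pqru: "distinct [p, q, r, u]" "{p, q, r, u} \<subseteq> A'"
        using ys D' by auto
      have "acts_by E (double_transposition p q r u) 1"
        using pqru A' by (intro all double_transposition_even) auto
      then have "acts_by E x 1"
        using double_transposition_acts_trivially[OF A _ inv pqru(1) _ _ less.prems(6)] pqru A' 3 by auto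
      then show False using less.prems(7) by simp
    qed
    then obtain s y where s: "s = 1 \<or> s = - 1" and y: "y \<in> even_perms A'" "\<not> acts_by (Es s) y 1" by blast
    have "\<exists>e. orthonormal_family X (card A' div 4) e \<and> (\<forall>j<card A' div 4. e j \<in> Es s)"
    proof (rule less.hyps[of A' "Es s" y])
      show "card A' < card A" using cardA' 3 by simp
      show "even_perms A' \<subseteq> X" using sub AX by blast
      show "v g = 0" if "v \<in> Es s" "g \<notin> X" for v g using that supp EsE by blast
    qed (use A' linEs invEs y in auto)
    then obtain e where e: "orthonormal_family X (card A' div 4) e" "\<And>j. j < card A' div 4 \<Longrightarrow> e j \<in> Es s"
      by blast
    obtain w where w: "w \<in> Es (- s)" "ip X w w \<noteq> 0" using nontriv[OF s] by blast
    have "\<exists>e'. orthonormal_family X (Suc (card A' div 4)) e' \<and> (\<forall>j<Suc (card A' div 4). e' j \<in> E)"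
    proof (rule orthonormal_family_extend[OF finite_X e(1) _ E])
      show "ip X w (e j) = 0" if "j < card A' div 4" for j
        using orth[OF e(2)[OF that] w(1)] s ip_commute[of X w "e j"] by auto
    qed (use w e EsE in auto)
    moreover have "card A div 4 = Suc (card A' div 4)" using cardA' 3 by simp
    ultimately show ?thesis by simp
  qed
qed

end

section \<open>Eigenspaces of the adjacency operator\<close>

definition adj :: "('a \<Rightarrow> 'a) set \<Rightarrow> ('a \<Rightarrow> 'a) set \<Rightarrow> (('a \<Rightarrow> 'a) \<Rightarrow> real) \<Rightarrow> ('a \<Rightarrow> 'a) \<Rightarrow> real" where
  "adj X S v g = (if g \<in> X then \<Sum>s\<in>S. v (g \<circ> s) else 0)"

definition rsign :: "('a \<Rightarrow> 'a) \<Rightarrow> real" where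
  "rsign g = of_int (sign g)"

lemma rsign_cases: "rsign g = (if evenperm g then 1 else - 1)"
  by (simp add: rsign_def sign_def)

lemma rsign_square [simp]: "rsign g * rsign g = 1"
  by (simp add: rsign_cases)

locale cayley_perm_group = perm_group X for X :: "('a \<Rightarrow> 'a) set" +
  fixes A :: "'a set" and S :: "('a \<Rightarrow> 'a) set"
  assumes finite_A: "finite A"
    and even_subset: "even_perms A \<subseteq> X"
    and permutes_A: "\<And>x. x \<in> X \<Longrightarrow> x permutes A"
    and S_subset: "S \<subseteq> X"
    and S_symmetric: "Hilbert_Choice.inv ` S = S"
begin

text \<open>The orthogonal complement of the constant and sign functions on \<open>X\<close>. When
  \<open>X\<close> contains only even permutations the two sum conditions coincide.\<close>

definition V0 :: "(('a \<Rightarrow> 'a) \<Rightarrow> real) set" where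
  "V0 = {v. (\<forall>g. g \<notin> X \<longrightarrow> v g = 0) \<and> (\<Sum>g\<in>X. v g) = 0 \<and> (\<Sum>g\<in>X. rsign g * v g) = 0}"

text \<open>Taken inside \<open>V0\<close>, so that no eigenspace contains a constant or sign
  function even if its eigenvalue agrees with theirs. For a \<open>c\<close> that is not an
  eigenvalue it is the zero space.\<close>

definition eigenspace :: "real \<Rightarrow> (('a \<Rightarrow> 'a) \<Rightarrow> real) set" where
  "eigenspace c = {v \<in> V0. \<forall>g. adj X S v g = c * v g}"

lemma rsign_comp: "x \<in> X \<Longrightarrow> y \<in> X \<Longrightarrow> rsign (x \<circ> y) = rsign x * rsign y"
  using even_perms_permutation[OF finite_A permutes_A]
  by (simp add: rsign_cases evenperm_comp)

lemma comp_mem_iff: "x \<in> X \<Longrightarrow> x \<circ> g \<in> X \<longleftrightarrow> g \<in> X"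
  using comp_mem inverse[of x] inv_comp(1)[of x g] by metis

lemma lin_V0: "lin_subspace V0"
  unfolding lin_subspace_def V0_def
  by (auto simp: sum.distrib distrib_left mult.left_commute simp flip: sum_distrib_left)

lemma adj_sum: "finite J \<Longrightarrow> adj X S (\<lambda>g. \<Sum>j\<in>J. c j * u j g) = (\<lambda>g. \<Sum>j\<in>J. c j * adj X S (u j) g)"
proof
  fix g
  have "(\<Sum>s\<in>S. \<Sum>j\<in>J. c j * u j (g \<circ> s)) = (\<Sum>j\<in>J. \<Sum>s\<in>S. c j * u j (g \<circ> s))" by (rule sum.swap)
  then show "adj X S (\<lambda>g. \<Sum>j\<in>J. c j * u j g) g = (\<Sum>j\<in>J. c j * adj X S (u j) g)"
    by (simp add: adj_def sum_distrib_left)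
qed

lemma V0_I:
  assumes "\<And>g. g \<notin> X \<Longrightarrow> v g = 0" "(\<Sum>g\<in>X. v g) = 0" "(\<Sum>g\<in>X. rsign g * v g) = 0"
  shows "v \<in> V0"
  using assms unfolding V0_def by blast

lemma V0_D:
  assumes "v \<in> V0"
  shows "\<And>g. g \<notin> X \<Longrightarrow> v g = 0" "(\<Sum>g\<in>X. v g) = 0" "(\<Sum>g\<in>X. rsign g * v g) = 0"
  using assms unfolding V0_def by blast+

lemma eigenspace_I: "v \<in> V0 \<Longrightarrow> (\<And>g. adj X S v g = c * v g) \<Longrightarrow> v \<in> eigenspace c"
  by (simp add: eigenspace_def)

lemma eigenspace_D:
  assumes "v \<in> eigenspace c"
  shows "v \<in> V0" "\<And>g. adj X S v g = c * v g"
  using assms by (simp_all add: eigenspace_def)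

lemma lin_eigenspace: "lin_subspace (eigenspace c)"
  unfolding lin_subspace_def
proof (intro conjI ballI allI)
  show "(\<lambda>_. 0) \<in> eigenspace c"
    using lin_V0 by (intro eigenspace_I) (simp_all add: lin_subspace_def adj_def)
  fix u assume u: "u \<in> eigenspace c"
  show "(\<lambda>g. u g + v g) \<in> eigenspace c" if v: "v \<in> eigenspace c" for v
  proof (rule eigenspace_I)
    show "adj X S (\<lambda>g. u g + v g) g = c * (u g + v g)" for g
      using eigenspace_D(2)[OF u, of g] eigenspace_D(2)[OF v, of g]
      by (auto simp: adj_def sum.distrib distrib_left split: if_splits)
  qed (intro lin_subspace_add[OF lin_V0] eigenspace_D(1)[OF u] eigenspace_D(1)[OF v])
  show "(\<lambda>g. a * u g) \<in> eigenspace c" for a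
  proof (rule eigenspace_I)
    show "adj X S (\<lambda>g. a * u g) g = c * (a * u g)" for g
      using eigenspace_D(2)[OF u, of g]
      by (simp add: adj_def mult.left_commute split: if_splits flip: sum_distrib_left)
  qed (intro lin_subspace_scale[OF lin_V0] eigenspace_D(1)[OF u])
qed

lemma adj_V0:
  assumes v: "v \<in> V0"
  shows "adj X S v \<in> V0"
proof -
  have "(\<Sum>g\<in>X. adj X S v g) = (\<Sum>s\<in>S. \<Sum>g\<in>X. v (g \<circ> s))"
    by (subst sum.swap) (simp add: adj_def)
  also have "\<dots> = 0"
  proof (rule sum.neutral, rule ballI)
    fix s assume "s \<in> S"
    then have s: "s \<in> X" using S_subset by blast
    show "(\<Sum>g\<in>X. v (g \<circ> s)) = 0" unfolding sum_right_mult[OF s] by (rule V0_D(2)[OF v])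
  qed
  finally have 1: "(\<Sum>g\<in>X. adj X S v g) = 0" .
  have "(\<Sum>g\<in>X. rsign g * adj X S v g) = (\<Sum>s\<in>S. \<Sum>g\<in>X. rsign g * v (g \<circ> s))"
    by (subst sum.swap) (simp add: adj_def sum_distrib_left)
  also have "\<dots> = 0"
  proof (rule sum.neutral, rule ballI)
    fix s assume "s \<in> S"
    then have s: "s \<in> X" using S_subset by blast
    have "(\<Sum>g\<in>X. rsign g * v (g \<circ> s)) = (\<Sum>g\<in>X. rsign s * (rsign (g \<circ> s) * v (g \<circ> s)))"
      using s by (intro sum.cong refl) (simp add: rsign_comp flip: mult.assoc)
    also have "\<dots> = rsign s * (\<Sum>g\<in>X. rsign (g \<circ> s) * v (g \<circ> s))" by (simp add: sum_distrib_left)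
    also have "(\<Sum>g\<in>X. rsign (g \<circ> s) * v (g \<circ> s)) = (\<Sum>g\<in>X. rsign g * v g)"
      by (rule sum_right_mult[OF s, of "\<lambda>g. rsign g * v g"])
    also have "\<dots> = 0" by (rule V0_D(3)[OF v])
    finally show "(\<Sum>g\<in>X. rsign g * v (g \<circ> s)) = 0" by (simp only: mult_zero_right)
  qed
  finally show ?thesis using 1 by (simp add: V0_def adj_def)
qed

text \<open>Right translation by \<open>s\<close> has right translation by the inverse of
  \<open>s\<close> as adjoint; this is where the symmetry of \<open>S\<close> enters.\<close>

lemma adj_symmetric: "ip X (adj X S u) v = ip X u (adj X S v)"
proof -
  have "ip X (adj X S u) v = (\<Sum>s\<in>S. \<Sum>g\<in>X. u (g \<circ> s) * v g)"
    unfolding ip_def by (subst sum.swap) (simp add: adj_def sum_distrib_right)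
  also have "\<dots> = (\<Sum>s\<in>S. \<Sum>g\<in>X. u g * v (g \<circ> Hilbert_Choice.inv s))"
  proof (rule sum.cong[OF refl])
    fix s assume "s \<in> S"
    then have s: "s \<in> X" using S_subset by blast
    then have i: "Hilbert_Choice.inv s \<in> X" using inverse by blast
    show "(\<Sum>g\<in>X. u (g \<circ> s) * v g) = (\<Sum>g\<in>X. u g * v (g \<circ> Hilbert_Choice.inv s))"
      using sum_right_mult[OF i, of "\<lambda>g. u (g \<circ> s) * v g"] by (simp only: inv_comp[OF s])
  qed
  also have "\<dots> = (\<Sum>s\<in>S. \<Sum>g\<in>X. u g * v (g \<circ> s))"
  proof -
    have "inj_on Hilbert_Choice.inv S"
      using S_subset inverse by (intro inj_onI) (metis inv_inv_eq subsetD)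
    then show ?thesis
      using sum.reindex[of Hilbert_Choice.inv S "\<lambda>s. \<Sum>g\<in>X. u g * v (g \<circ> s)"] S_symmetric by simp
  qed
  also have "\<dots> = ip X u (adj X S v)"
    unfolding ip_def by (subst sum.swap) (simp add: adj_def sum_distrib_left)
  finally show ?thesis .
qed

lemma eigenspace_left_invariant: "left_invariant X (eigenspace c)"
  unfolding left_invariant_def
proof (intro ballI)
  fix x v assume x: "x \<in> X" and v: "v \<in> eigenspace c"
  have "(\<Sum>g\<in>X. v (x \<circ> g)) = 0" using v by (simp add: sum_left_mult[OF x] eigenspace_def V0_def)
  moreover have "(\<Sum>g\<in>X. rsign g * v (x \<circ> g)) = 0"
  proof -
    have "(\<Sum>g\<in>X. rsign g * v (x \<circ> g)) = (\<Sum>g\<in>X. rsign x * (rsign (x \<circ> g) * v (x \<circ> g)))"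
      using x by (intro sum.cong refl) (simp add: rsign_comp flip: mult.assoc)
    also have "\<dots> = rsign x * (\<Sum>g\<in>X. rsign (x \<circ> g) * v (x \<circ> g))" by (simp add: sum_distrib_left)
    also have "(\<Sum>g\<in>X. rsign (x \<circ> g) * v (x \<circ> g)) = (\<Sum>g\<in>X. rsign g * v g)"
      by (rule sum_left_mult[OF x, of "\<lambda>g. rsign g * v g"])
    also have "\<dots> = 0" by (rule V0_D(3)[OF eigenspace_D(1)[OF v]])
    finally show ?thesis by (simp only: mult_zero_right)
  qed
  moreover have "adj X S (\<lambda>g. v (x \<circ> g)) g = adj X S v (x \<circ> g)" for g
    using x by (simp add: adj_def comp_mem_iff comp_assoc)
  moreover have "v (x \<circ> g) = 0" if "g \<notin> X" for g
    using V0_D(1)[OF eigenspace_D(1)[OF v]] comp_mem_iff[OF x] that by blast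
  ultimately show "(\<lambda>g. v (x \<circ> g)) \<in> eigenspace c"
    using eigenspace_D(2)[OF v] by (intro eigenspace_I V0_I) (simp_all only:)
qed

text \<open>The weight \<open>1 + r * rsign h\<close> vanishes unless \<open>h\<close> has the
  parity of \<open>g\<close>, and on those \<open>h\<close> the function equals \<open>v g\<close>.
  Its weighted sum is 0 by the two conditions in \<open>V0\<close>, while the total weight is
  positive.\<close>

lemma even_invariant_V0_eq_0:
  assumes v: "v \<in> V0" and inv: "\<And>x g. x \<in> even_perms A \<Longrightarrow> v (x \<circ> g) = v g"
  shows "v g = 0"
proof (cases "g \<in> X")
  case True
  define r where "r = rsign g"
  have "(\<Sum>h\<in>X. v h * (1 + r * rsign h)) = (\<Sum>h\<in>X. v h) + r * (\<Sum>h\<in>X. rsign h * v h)"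
    by (simp add: sum.distrib sum_distrib_left algebra_simps)
  also have "\<dots> = 0" using v by (simp add: V0_def)
  also have "(\<Sum>h\<in>X. v h * (1 + r * rsign h)) = (\<Sum>h\<in>X. v g * (1 + r * rsign h))"
  proof (intro sum.cong refl)
    fix h assume h: "h \<in> X"
    show "v h * (1 + r * rsign h) = v g * (1 + r * rsign h)"
    proof (cases "rsign h = r")
      case True
      define x where "x = h \<circ> Hilbert_Choice.inv g"
      have x: "x \<in> X" using h \<open>g \<in> X\<close> inverse by (auto simp: x_def intro: comp_mem)
      have xg: "x \<circ> g = h" using inv_comp(4)[OF \<open>g \<in> X\<close>] by (simp add: x_def)
      then have "rsign x = 1" using rsign_comp[OF x \<open>g \<in> X\<close>] True
        by (auto simp: r_def rsign_cases split: if_splits)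
      then have "x \<in> even_perms A" using permutes_A[OF x] by (simp add: even_perms_def rsign_cases split: if_splits)
      then show ?thesis using inv[of x g] xg by simp
    next
      case False
      then have "1 + r * rsign h = 0" by (auto simp: r_def rsign_cases split: if_splits)
      then show ?thesis by simp
    qed
  qed
  also have "\<dots> = v g * (\<Sum>h\<in>X. 1 + r * rsign h)" by (simp add: sum_distrib_left)
  finally have "v g * (\<Sum>h\<in>X. 1 + r * rsign h) = 0" .
  moreover have "1 + r * rsign g \<le> (\<Sum>h\<in>X. 1 + r * rsign h)"
    using True finite_X by (intro member_le_sum) (auto simp: r_def rsign_cases)
  ultimately show ?thesis by (auto simp: r_def)
qed (use v in \<open>simp add: V0_def\<close>)

text \<open>A nonzero function in \<open>V0\<close> is moved by some even permutation, so a nonzero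
  eigenspace is a nontrivial representation.\<close>

lemma eigenspace_dim:
  assumes e: "onb_of X (eigenspace c) d e" and d: "0 < d"
  shows "card A div 4 \<le> d"
proof -
  have e0: "e 0 \<in> eigenspace c" using e d by (simp add: onb_of_def)
  have "\<exists>x\<in>even_perms A. \<not> acts_by (eigenspace c) x 1"
  proof (rule ccontr)
    assume "\<not> ?thesis"
    then have inv: "e 0 (x \<circ> g) = e 0 g" if "x \<in> even_perms A" for x g
      using that e0 by (auto simp: acts_by_def)
    have "e 0 g = 0" for g by (rule even_invariant_V0_eq_0[OF eigenspace_D(1)[OF e0] inv])
    then have "ip X (e 0) (e 0) = 0" by (simp add: ip_def)
    then show False using e d orthonormal_familyD[of X d e 0 0] by (simp add: onb_of_def)
  qed
  then obtain x where x: "x \<in> even_perms A" "\<not> acts_by (eigenspace c) x 1" by blast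
  have inv: "left_invariant (even_perms A) (eigenspace c)"
    using eigenspace_left_invariant even_subset by (auto simp: left_invariant_def)
  have supp: "\<And>v g. v \<in> eigenspace c \<Longrightarrow> g \<notin> X \<Longrightarrow> v g = 0"
    using V0_D(1) eigenspace_D(1) by blast
  have "\<exists>b. orthonormal_family X (card A div 4) b \<and> (\<forall>j<card A div 4. b j \<in> eigenspace c)"
    by (rule even_perms_representation_dim[OF finite_A even_subset lin_eigenspace inv _ x]) (rule supp)
  then show ?thesis using onb_of_dim_ge[OF e] by blast
qed

section \<open>The constant and sign functions, and the eigenbasis\<close>

definition unit_one :: "('a \<Rightarrow> 'a) \<Rightarrow> real" where
  "unit_one g = (if g \<in> X then 1 / sqrt (card X) else 0)"

definition unit_sign :: "('a \<Rightarrow> 'a) \<Rightarrow> real" where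
  "unit_sign g = (if g \<in> X then rsign g / sqrt (card X) else 0)"

lemma card_X_pos: "0 < real (card X)"
  using finite_X id_mem by (auto simp: card_gt_0_iff)

lemma adj_unit_one: "adj X S unit_one g = real (card S) * unit_one g"
  using S_subset comp_mem by (auto simp: adj_def unit_one_def subset_iff)

lemma adj_unit_sign: "adj X S unit_sign g = (\<Sum>s\<in>S. rsign s) * unit_sign g"
proof (cases "g \<in> X")
  case True
  have "(\<Sum>s\<in>S. unit_sign (g \<circ> s)) = (\<Sum>s\<in>S. rsign s * unit_sign g)"
    using True S_subset comp_mem by (intro sum.cong refl) (auto simp: unit_sign_def rsign_comp subset_iff)
  then show ?thesis using True by (simp add: adj_def sum_distrib_right)
qed (simp add: adj_def unit_sign_def)

lemma unit_norm: "ip X unit_one unit_one = 1" "ip X unit_sign unit_sign = 1"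
  using card_X_pos by (simp_all add: ip_def unit_one_def unit_sign_def)

text \<open>Unequal functions mean that \<open>X\<close> has an odd element, and translation by it
  reverses the sign of the sum of \<open>rsign\<close> over \<open>X\<close>.\<close>

lemma unit_orthogonal:
  assumes "unit_one \<noteq> unit_sign"
  shows "ip X unit_one unit_sign = 0"
proof -
  obtain x where x: "x \<in> X" "rsign x = - 1"
    using assms by (fastforce simp: fun_eq_iff unit_one_def unit_sign_def rsign_cases split: if_splits)
  have "(\<Sum>g\<in>X. rsign g) = (\<Sum>g\<in>X. rsign (x \<circ> g))" by (rule sum_left_mult[OF x(1), symmetric])
  also have "\<dots> = - (\<Sum>g\<in>X. rsign g)" using x by (simp add: rsign_comp sum_negf)
  finally have "(\<Sum>g\<in>X. rsign g) = 0" by simp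
  moreover have "ip X unit_one unit_sign = (\<Sum>g\<in>X. rsign g) / card X"
    by (simp add: ip_def unit_one_def unit_sign_def sum_divide_distrib)
  ultimately show ?thesis by simp
qed

lemma V0_orthogonal:
  assumes "v \<in> V0"
  shows "ip X unit_one v = 0" "ip X unit_sign v = 0"
proof -
  have "ip X unit_one v = (\<Sum>g\<in>X. v g) / sqrt (card X)"
    by (simp add: ip_def unit_one_def sum_divide_distrib)
  then show "ip X unit_one v = 0" using assms by (simp add: V0_def)
  have "ip X unit_sign v = (\<Sum>g\<in>X. rsign g * v g) / sqrt (card X)"
    by (simp add: ip_def unit_sign_def sum_divide_distrib)
  then show "ip X unit_sign v = 0" using assms by (simp add: V0_def)
qed

lemma V0_I_orthogonal:
  assumes "\<And>g. g \<notin> X \<Longrightarrow> v g = 0" "ip X unit_one v = 0" "ip X unit_sign v = 0"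
  shows "v \<in> V0"
proof -
  have "ip X unit_one v = (\<Sum>g\<in>X. v g) / sqrt (card X)"
    by (simp add: ip_def unit_one_def sum_divide_distrib)
  moreover have "ip X unit_sign v = (\<Sum>g\<in>X. rsign g * v g) / sqrt (card X)"
    by (simp add: ip_def unit_sign_def sum_divide_distrib)
  ultimately show ?thesis using assms card_X_pos by (simp add: V0_def)
qed

lemma eigenspaces_orthogonal:
  assumes "u \<in> eigenspace a" "v \<in> eigenspace b" "a \<noteq> b"
  shows "ip X u v = 0"
proof -
  have "a * ip X u v = ip X (adj X S u) v"
    unfolding ip_scale_left[symmetric] using assms(1) by (intro ip_cong) (auto simp: eigenspace_def)
  also have "\<dots> = ip X u (adj X S v)" by (rule adj_symmetric)
  also have "\<dots> = b * ip X u v"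
    unfolding ip_scale_right[symmetric] using assms(2) by (intro ip_cong) (auto simp: eigenspace_def)
  finally show ?thesis using assms(3) by simp
qed

text \<open>Spanning is expressed as membership in every linear subspace that contains the
  eigenspaces. The spectral basis of \<open>V0\<close> consists of elements of eigenspaces.\<close>

lemma V0_spanned_by_eigenspaces:
  assumes E: "lin_subspace E" "\<And>c. eigenspace c \<subseteq> E" and v: "v \<in> V0"
  shows "v \<in> E"
proof -
  obtain d e lam where e: "onb_of X V0 d e" and ev: "\<And>j g. j < d \<Longrightarrow> g \<in> X \<Longrightarrow> adj X S (e j) g = lam j * e j g"
    using spectral_basis[OF finite_X lin_V0 adj_sum adj_symmetric adj_V0] by blast
  have eE: "e j \<in> E" if "j < d" for j
  proof -
    have eV: "e j \<in> V0" using e that by (simp add: onb_of_def)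
    then have "adj X S (e j) g = lam j * e j g" for g
      using ev[OF that] by (cases "g \<in> X") (auto simp: V0_def adj_def)
    then show ?thesis using eV E(2) by (auto simp: eigenspace_def)
  qed
  have "v g = (\<Sum>j<d. ip X v (e j) * e j g)" for g
  proof (cases "g \<in> X")
    case False
    then have "e j g = 0" if "j < d" for j using e that by (simp add: onb_of_def V0_def)
    then show ?thesis using False v by (simp add: V0_def)
  qed (rule onb_of_expand[OF e v])
  then have "v = (\<lambda>g. \<Sum>j<d. ip X v (e j) * e j g)" by blast
  also have "\<dots> \<in> E" using eE by (intro lin_subspace_sum[OF E(1)]) auto
  finally show ?thesis .
qed

lemma spanned_by_units_and_eigenspaces:
  assumes E: "lin_subspace E" "\<And>c. eigenspace c \<subseteq> E" "unit_one \<in> E" "unit_sign \<in> E"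
    and v: "\<And>g. g \<notin> X \<Longrightarrow> v g = 0"
  shows "v \<in> E"
proof -
  \<comment> \<open>The coefficient is 0 if the two unit functions coincide; otherwise their common
    component would be subtracted twice.\<close>
  define b where "b = (if unit_one = unit_sign then 0 else ip X unit_sign v)"
  define p where "p = (\<lambda>g. ip X unit_one v * unit_one g + b * unit_sign g)"
  have pE: "p \<in> E" unfolding p_def by (intro lin_subspace_add lin_subspace_scale E)
  have so: "ip X unit_sign unit_one = ip X unit_one unit_sign" by (rule ip_commute)
  have pp: "ip X w p = ip X unit_one v * ip X w unit_one + b * ip X w unit_sign" for w
    using ip_add_left[of X "\<lambda>g. ip X unit_one v * unit_one g" "\<lambda>g. b * unit_sign g" w]
    by (simp add: p_def ip_commute[of X w] ip_scale_left)
  have "(\<lambda>g. v g - p g) \<in> V0"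
  proof (rule V0_I_orthogonal)
    show "v g - p g = 0" if "g \<notin> X" for g using that v by (simp add: p_def unit_one_def unit_sign_def)
    show "ip X unit_one (\<lambda>g. v g - p g) = 0"
      using unit_orthogonal by (auto simp: ip_diff_right pp unit_norm b_def)
    show "ip X unit_sign (\<lambda>g. v g - p g) = 0"
    proof (cases "unit_one = unit_sign")
      case True
      then show ?thesis using unit_norm by (simp add: ip_diff_right pp b_def)
    next
      case False
      then show ?thesis using unit_orthogonal[OF False] unit_norm by (simp add: ip_diff_right pp so b_def)
    qed
  qed
  then have "(\<lambda>g. v g - p g) \<in> E" by (rule V0_spanned_by_eigenspaces[OF E(1,2)])
  then have "(\<lambda>g. (v g - p g) + p g) \<in> E" using pE by (rule lin_subspace_add[OF E(1)])
  then show ?thesis by simp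
qed

text \<open>The last clause is spanning, phrased by subspaces so that it can later be applied to the
  real functions whose complexification lies in a complex span.\<close>

definition eigenbasis :: "(('a \<Rightarrow> 'a) \<Rightarrow> real) set \<Rightarrow> bool" where
  "eigenbasis B \<longleftrightarrow> (\<forall>\<phi>\<in>B. \<forall>g. g \<notin> X \<longrightarrow> \<phi> g = 0) \<and>
     (\<forall>\<phi>\<in>B. \<forall>\<psi>\<in>B. ip X \<phi> \<psi> = of_bool (\<phi> = \<psi>)) \<and>
     (\<forall>\<phi>\<in>B. \<exists>c. \<forall>g. adj X S \<phi> g = c * \<phi> g) \<and>
     (\<forall>E v. lin_subspace E \<and> B \<subseteq> E \<and> (\<forall>g. g \<notin> X \<longrightarrow> v g = 0) \<longrightarrow> v \<in> E)"

text \<open>The number \<open>d\<close> may depend on \<open>\<phi>\<close>: for a function from an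
  eigenspace it is the dimension of that space, which may be far larger than \<open>card A\<close>,
  so the bound is not yet expressed by \<open>card A\<close>.\<close>

lemma balanced_eigenbasis:
  fixes F :: "nat \<Rightarrow> ('a \<Rightarrow> 'a) \<Rightarrow> real"
  shows "\<exists>B. eigenbasis B \<and> (\<forall>\<phi>\<in>B. \<exists>d>0. card A div 4 \<le> d \<and> (\<forall>i<M.
    \<bar>(\<Sum>g\<in>X. F i g * (\<phi> g)\<^sup>2) - (\<Sum>g\<in>X. F i g) / card X\<bar>
      \<le> 16 * max 1 (ln (real M * real d)) / sqrt d * (sqrt (\<Sum>g\<in>X. (F i g)\<^sup>2) / sqrt (card X))))"
proof -
  define bound where "bound = (\<lambda>d \<phi>. \<forall>i<M.
    \<bar>(\<Sum>g\<in>X. F i g * (\<phi> g)\<^sup>2) - (\<Sum>g\<in>X. F i g) / card X\<bar>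
      \<le> 16 * max 1 (ln (real M * real d)) / sqrt d * (sqrt (\<Sum>g\<in>X. (F i g)\<^sup>2) / sqrt (card X)))"
  have "\<exists>d e. onb_of X (eigenspace c) d e \<and> (\<forall>j<d. bound d (e j))" for c
  proof -
    have "\<And>x v. x \<in> X \<Longrightarrow> v \<in> eigenspace c \<Longrightarrow> (\<lambda>g. v (x \<circ> g)) \<in> eigenspace c"
      using eigenspace_left_invariant by (simp add: left_invariant_def)
    from balanced_basis[OF lin_eigenspace this, of M F] show ?thesis unfolding bound_def by blast
  qed
  then obtain d e where e: "\<And>c. onb_of X (eigenspace c) (d c) (e c)"
    and bd: "\<And>c j. j < d c \<Longrightarrow> bound (d c) (e c j)" by metis
  \<comment> \<open>The union runs over all real \<open>c\<close>, and zero eigenspaces contribute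
    nothing. As a set, \<open>B\<close> contains the constant and sign functions only once when they
    coincide.\<close>
  define B where "B = {unit_one, unit_sign} \<union> (\<Union>c. e c ` {..<d c})"
  have eE: "e c j \<in> eigenspace c" if "j < d c" for c j using e that by (simp add: onb_of_def)
  have eV: "e c j \<in> V0" if "j < d c" for c j using eE[OF that] by (simp add: eigenspace_def)
  have cases_B: "\<phi> = unit_one \<or> \<phi> = unit_sign \<or> (\<exists>c. \<exists>j<d c. \<phi> = e c j)" if "\<phi> \<in> B" for \<phi>
    using that by (auto simp: B_def)
  have norm: "ip X \<phi> \<phi> = 1" if "\<phi> \<in> B" for \<phi>
    using cases_B[OF that] unit_norm e orthonormal_familyD unfolding onb_of_def by fastforce
  have ee: "ip X (e a j) (e b k) = 0" if "j < d a" "k < d b" "e a j \<noteq> e b k" for a b j k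
  proof (cases "a = b")
    case True
    then show ?thesis using e[of a] that orthonormal_familyD[of X "d a" "e a" j k] by (auto simp: onb_of_def)
  next
    case False
    then show ?thesis using eigenspaces_orthogonal eE that by blast
  qed
  have ue: "ip X unit_one (e c j) = 0" "ip X unit_sign (e c j) = 0"
    "ip X (e c j) unit_one = 0" "ip X (e c j) unit_sign = 0" if "j < d c" for c j
    using V0_orthogonal[OF eV[OF that]] by (simp_all add: ip_commute)
  have orth: "ip X \<phi> \<psi> = 0" if "\<phi> \<in> B" "\<psi> \<in> B" "\<phi> \<noteq> \<psi>" for \<phi> \<psi>
    using cases_B[OF that(1)] cases_B[OF that(2)] that(3) unit_orthogonal ip_commute[of X unit_sign unit_one] ue ee
    by (elim disjE exE conjE) auto
  have span: "v \<in> E" if E: "lin_subspace E" "B \<subseteq> E" and v: "\<forall>g. g \<notin> X \<longrightarrow> v g = 0" for E v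
  proof (rule spanned_by_units_and_eigenspaces[OF E(1)])
    show "eigenspace c \<subseteq> E" for c
    proof
      fix u assume u: "u \<in> eigenspace c"
      have "u g = (\<Sum>j<d c. ip X u (e c j) * e c j g)" for g
      proof (cases "g \<in> X")
        case False
        then show ?thesis using u eV by (auto simp: eigenspace_def V0_def)
      qed (rule onb_of_expand[OF e u])
      then have "u = (\<lambda>g. \<Sum>j<d c. ip X u (e c j) * e c j g)" by blast
      also have "\<dots> \<in> E" using E(2) by (intro lin_subspace_sum[OF E(1)]) (auto simp: B_def)
      finally show "u \<in> E" .
    qed
  qed (use E v in \<open>auto simp: B_def\<close>)
  have supp: "\<phi> g = 0" if "\<phi> \<in> B" "g \<notin> X" for \<phi> g
    using cases_B[OF that(1)] that(2) eV by (auto simp: unit_one_def unit_sign_def V0_def)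
  have eig: "\<exists>c. \<forall>g. adj X S \<phi> g = c * \<phi> g" if "\<phi> \<in> B" for \<phi>
    using cases_B[OF that] adj_unit_one adj_unit_sign eE unfolding eigenspace_def by blast
  have "eigenbasis B" unfolding eigenbasis_def using norm orth span supp eig by (simp add: of_bool_def)
  moreover have "\<exists>d>0. card A div 4 \<le> d \<and> bound d \<phi>" if \<phi>: "\<phi> \<in> B" for \<phi>
  proof (cases "\<phi> \<in> {unit_one, unit_sign}")
    \<comment> \<open>The deviation is exactly 0, so any positive \<open>d\<close> that is large
      enough serves.\<close>
    case True
    then have "(\<phi> g)\<^sup>2 = 1 / card X" if "g \<in> X" for g
      using that by (auto simp: unit_one_def unit_sign_def power_divide rsign_cases)
    then have "(\<Sum>g\<in>X. f g * (\<phi> g)\<^sup>2) = (\<Sum>g\<in>X. f g) / card X" for f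
      by (simp add: sum_divide_distrib)
    then have "bound d \<phi>" for d
      unfolding bound_def by (auto intro!: mult_nonneg_nonneg divide_nonneg_nonneg sum_nonneg)
    then show ?thesis by (intro exI[of _ "Suc (card A div 4)"]) simp
  next
    case False
    then obtain c j where cj: "j < d c" "\<phi> = e c j" using cases_B[OF \<phi>] by blast
    then show ?thesis using bd eigenspace_dim[OF e, of c] by (intro exI[of _ "d c"]) auto
  qed
  ultimately show ?thesis unfolding bound_def by blast
qed

end

section \<open>Comparison of the dimension with the degree\<close>

lemma log_sqrt_bound:
  fixes n d M :: nat
  assumes n: "n \<ge> 20" and d: "n div 4 \<le> d" and M: "1 \<le> M" "real M \<le> real n / 5"
  shows "16 * max 1 (ln (real M * real d)) / sqrt d \<le> 192 * (ln (real n) / sqrt (real n))"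
proof -
  have "4 * (n div 4) + 3 \<ge> n" by presburger
  then have "4 * d + 3 \<ge> n" using d by linarith
  then have "4 * real d + 3 \<ge> real n" by linarith
  \<comment> \<open>From \<open>n \<le> 4 * d + 3\<close> and \<open>n \<ge> 20\<close> it follows
    that \<open>3 \<le> d\<close>, so the remainder 3 is covered by one more
    \<open>d\<close>.\<close>
  then have d5: "real n \<le> 5 * real d" using n by linarith
  then have d4: "real d \<ge> 4" and n20: "real n \<ge> 20" using n by linarith+
  have e3: "exp 1 \<le> (3 :: real)" by (rule exp_le)
  have "exp 1 \<le> real d" using e3 d4 by linarith
  then have lnd: "1 \<le> ln d" using d4 by (simp add: ln_ge_iff)
  have "exp 2 = exp 1 * (exp 1 :: real)" by (simp flip: exp_add)
  also have "\<dots> \<le> 3 * 3" using e3 by (intro mult_mono) auto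
  finally have "exp 2 \<le> real n" using n20 by linarith
  then have lnn: "2 \<le> ln n" using n20 by (simp add: ln_ge_iff)
  have "ln (real M * real d) = ln M + ln d" using M d4 by (simp add: ln_mult)
  moreover have "ln M \<le> ln d" using M d5 by simp
  ultimately have "max 1 (ln (real M * real d)) \<le> 2 * ln d" using lnd by simp
  then have "16 * max 1 (ln (real M * real d)) / sqrt d \<le> 16 * (2 * ln d) / sqrt d"
    by (intro divide_right_mono mult_left_mono) auto
  \<comment> \<open>The quotient \<open>ln d / sqrt d\<close> is at most 3 times
    \<open>ln n / sqrt n\<close> if \<open>d \<le> n\<close>, and at most
    \<open>ln n / sqrt n\<close> otherwise. The resulting constant \<open>32 * 3 = 96\<close> lies
    below 192.\<close>
  also have "\<dots> \<le> 192 * (ln n / sqrt n)"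
  proof (cases "d \<le> n")
    case True
    have "sqrt n \<le> sqrt (5 * real d)" using d5 by simp
    also have "\<dots> \<le> sqrt (3\<^sup>2 * real d)" by (intro real_sqrt_le_mono) simp
    also have "\<dots> = 3 * sqrt d" by (simp add: real_sqrt_mult)
    finally have s: "sqrt n \<le> 3 * sqrt d" .
    have "ln d * sqrt n \<le> ln n * (3 * sqrt d)"
      using True d4 lnn s by (intro mult_mono) auto
    then have "ln d / sqrt d \<le> 3 * (ln n / sqrt n)" using d4 n20 by (simp add: field_simps)
    moreover have "0 \<le> ln n / sqrt n" using lnn by simp
    ultimately show ?thesis by simp
  next
    case False
    \<comment> \<open>Writing \<open>d = n * r\<^sup>2\<close> and using
      \<open>ln r \<le> r - 1\<close> and \<open>2 \<le> ln n\<close> gives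
      \<open>ln d \<le> r * ln n\<close>, an explicit form of the decay of
      \<open>ln x / sqrt x\<close> beyond \<open>exp 2\<close>.\<close>
    define r where "r = sqrt (d / n)"
    have r1: "r \<ge> 1" using False n20 by (simp add: r_def)
    have "real d = n * r\<^sup>2" using n20 by (simp add: r_def)
    then have "ln d = ln n + 2 * ln r" using r1 n20 by (simp add: ln_mult ln_realpow)
    also have "\<dots> \<le> ln n + 2 * (r - 1)" using ln_le_minus_one[of r] r1 by simp
    also have "\<dots> \<le> ln n + ln n * (r - 1)" using lnn r1 by (intro add_left_mono mult_right_mono) auto
    finally have "ln d \<le> ln n * r" by (simp add: algebra_simps)
    then have "ln d / sqrt d \<le> ln n * r / sqrt d" by (intro divide_right_mono) auto
    also have "\<dots> = ln n / sqrt n" using d4 n20 by (simp add: r_def real_sqrt_divide)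
    finally have "ln d / sqrt d \<le> ln n / sqrt n" .
    moreover have "0 \<le> ln n / sqrt n" using lnn by simp
    ultimately show ?thesis by simp
  qed
  finally show ?thesis .
qed

section \<open>Passage to complex-valued functions\<close>

definition complexify :: "('a \<Rightarrow> real) \<Rightarrow> 'a \<Rightarrow> complex" where
  "complexify v = (\<lambda>g. complex_of_real (v g))"

lemma inj_complexify: "inj complexify"
  by (rule injI) (simp add: complexify_def fun_eq_iff)

lemma ell2_inner_complexify: "ell2_inner G (complexify u) (complexify v) = of_real (ip (carrier G) u v)"
  by (simp add: ell2_inner_def complexify_def ip_def)

lemma ell2_norm_of_real: "ell2_norm G (\<lambda>g. complex_of_real (f g)) = sqrt (\<Sum>g\<in>carrier G. (f g)\<^sup>2)"
  by (simp add: ell2_norm_def ell2_inner_def power2_eq_square)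

lemma mass_complexify: "mass G (complexify v) f = (\<Sum>g\<in>carrier G. f g * (v g)\<^sup>2)"
  by (simp add: mass_def complexify_def)

text \<open>The real functions whose complexification lies in the complex span form a real subspace
  containing \<open>B\<close>, hence include all real functions supported on the group. Real and
  imaginary parts do the rest.\<close>

lemma span_complexify:
  fixes B :: "('a \<Rightarrow> real) set"
  assumes supp: "\<And>\<phi> g. \<phi> \<in> B \<Longrightarrow> g \<notin> carrier G \<Longrightarrow> \<phi> g = 0"
    and span: "\<And>E v. lin_subspace E \<Longrightarrow> B \<subseteq> E \<Longrightarrow> (\<forall>g. g \<notin> carrier G \<longrightarrow> v g = 0) \<Longrightarrow> v \<in> E"
  shows "module.span fun_scale (complexify ` B) = ell2 G"
proof -
  interpret vector_space "fun_scale :: complex \<Rightarrow> ('a \<Rightarrow> complex) \<Rightarrow> 'a \<Rightarrow> complex"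
    by (rule vector_space_fun_scale)
  define E where "E = {v. complexify v \<in> span (complexify ` B)}"
  have lin: "lin_subspace E" unfolding lin_subspace_def
  proof (intro conjI ballI allI)
    show "(\<lambda>_. 0) \<in> E" using span_zero[of "complexify ` B"]
      by (simp add: E_def complexify_def zero_fun_def)
    fix u assume u: "u \<in> E"
    show "(\<lambda>g. u g + v g) \<in> E" if "v \<in> E" for v
      using span_add[of "complexify u" "complexify ` B" "complexify v"] u that
      by (simp add: E_def complexify_def plus_fun_def)
    show "(\<lambda>g. c * u g) \<in> E" for c
      using span_scale[of "complexify u" "complexify ` B" "complex_of_real c"] u
      by (simp add: E_def complexify_def fun_scale_def)
  qed
  have BE: "B \<subseteq> E" by (auto simp: E_def intro: span_base)
  show ?thesis
  proof
    have "subspace (ell2 G)"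
      by (rule subspaceI) (auto simp: ell2_def fun_scale_def)
    moreover have "complexify ` B \<subseteq> ell2 G" using supp by (auto simp: ell2_def complexify_def)
    ultimately show "span (complexify ` B) \<subseteq> ell2 G" by (simp add: span_minimal)
    show "ell2 G \<subseteq> span (complexify ` B)"
    proof
      fix w assume w: "w \<in> ell2 G"
      have "(\<lambda>g. Re (w g)) \<in> E" "(\<lambda>g. Im (w g)) \<in> E"
        using w by (auto intro!: span[OF lin BE] simp: ell2_def)
      then have "complexify (\<lambda>g. Re (w g)) + fun_scale \<i> (complexify (\<lambda>g. Im (w g))) \<in> span (complexify ` B)"
        by (intro span_add span_scale) (simp_all add: E_def)
      also have "complexify (\<lambda>g. Re (w g)) + fun_scale \<i> (complexify (\<lambda>g. Im (w g))) = w"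
        by (simp add: fun_eq_iff complexify_def fun_scale_def flip: complex_eq)
      finally show "w \<in> span (complexify ` B)" .
    qed
  qed
qed

lemma alt_or_sym_cayley_perm_group:
  assumes G: "G = alt_group n \<or> G = sym_group n"
    and S: "S \<subseteq> carrier G" "set_inv\<^bsub>G\<^esub> S = S"
  shows "cayley_perm_group (carrier G) {1..n} S"
proof
  have perm: "\<And>x. x \<in> carrier G \<Longrightarrow> x permutes {1..n}"
    using G by (auto simp: sym_group_carrier alt_group_carrier)
  have "group G" using G sym_group_is_group alt_group_is_group by blast
  then interpret group G .
  have mult: "mult G = (\<circ>)" and one: "one G = id"
    using G by (auto simp: sym_group_mult alt_group_mult sym_group_one alt_group_one)
  have inv: "m_inv G x = Hilbert_Choice.inv x" if "x \<in> carrier G" for x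
    using G that sym_group_inv_equality alt_group_inv_equality by blast
  show "finite (carrier G)"
    by (rule finite_subset[OF _ finite_permutations[of "{1..n}"]]) (use perm in auto)
  show "id \<in> carrier G" using one_closed one by simp
  show "x \<circ> y \<in> carrier G" if "x \<in> carrier G" "y \<in> carrier G" for x y
    using m_closed[OF that] mult by simp
  show "bij x \<and> Hilbert_Choice.inv x \<in> carrier G" if "x \<in> carrier G" for x
    using permutes_bij[OF perm[OF that]] inv[OF that] inv_closed[OF that] by simp
  show "finite {1..n}" by simp
  show "even_perms {1..n} \<subseteq> carrier G"
    using G by (auto simp: even_perms_def sym_group_carrier alt_group_carrier)
  show "x permutes {1..n}" if "x \<in> carrier G" for x by (rule perm[OF that])
  show "S \<subseteq> carrier G" by (rule S)
  have "set_inv\<^bsub>G\<^esub> S = Hilbert_Choice.inv ` S"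
    using S(1) inv by (auto simp: SET_INV_def subset_iff)
  then show "Hilbert_Choice.inv ` S = S" using S(2) by simp
qed

lemma alt_or_sym_balanced_eigenbasis:
  fixes f :: "nat \<Rightarrow> (nat \<Rightarrow> nat) \<Rightarrow> real"
  assumes G: "G = alt_group n \<or> G = sym_group n"
    and S: "S \<subseteq> carrier G" "set_inv\<^bsub>G\<^esub> S = S"
  shows "\<exists>B. orthonormal_basis G B \<and>
    (\<forall>\<phi>\<in>B. cayley_eigenfunction G S \<phi> \<and> (\<forall>g\<in>carrier G. \<phi> g \<in> \<real>)) \<and>
    (\<forall>\<phi>\<in>B. \<exists>d>0. n div 4 \<le> d \<and> (\<forall>i\<in>{1..M}.
       \<bar>mass G \<phi> (f i) - (\<Sum>g\<in>carrier G. f i g) / real (order G)\<bar>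
         \<le> 16 * max 1 (ln (real M * real d)) / sqrt d *
           (ell2_norm G (\<lambda>g. complex_of_real (f i g)) / sqrt (real (order G)))))"
proof -
  interpret cayley_perm_group "carrier G" "{1..n}" S
    by (rule alt_or_sym_cayley_perm_group[OF G S])
  have mult: "mult G = (\<circ>)" using G by (auto simp: sym_group_mult alt_group_mult)
  \<comment> \<open>The real statement numbers the functions from 0, the theorem from 1; hence the
    shift \<open>f (Suc i)\<close>.\<close>
  obtain B where B: "eigenbasis B" and bd: "\<And>\<phi>. \<phi> \<in> B \<Longrightarrow> \<exists>d>0. card {1..n} div 4 \<le> d \<and> (\<forall>i<M.
    \<bar>(\<Sum>g\<in>carrier G. f (Suc i) g * (\<phi> g)\<^sup>2) - (\<Sum>g\<in>carrier G. f (Suc i) g) / card (carrier G)\<bar>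
      \<le> 16 * max 1 (ln (real M * real d)) / sqrt d *
        (sqrt (\<Sum>g\<in>carrier G. (f (Suc i) g)\<^sup>2) / sqrt (card (carrier G))))"
    using balanced_eigenbasis[where F = "\<lambda>i. f (Suc i)" and M = M] by blast
  have supp: "\<phi> g = 0" if "\<phi> \<in> B" "g \<notin> carrier G" for \<phi> g
    using B that unfolding eigenbasis_def by blast
  have on: "ip (carrier G) \<phi> \<psi> = of_bool (\<phi> = \<psi>)" if "\<phi> \<in> B" "\<psi> \<in> B" for \<phi> \<psi>
    using B that unfolding eigenbasis_def by blast
  have "orthonormal_basis G (complexify ` B)"
    unfolding orthonormal_basis_def
  proof (intro conjI)
    show "complexify ` B \<subseteq> ell2 G" using supp by (auto simp: ell2_def complexify_def)
    show "\<forall>\<phi>\<in>complexify ` B. \<forall>\<psi>\<in>complexify ` B. ell2_inner G \<phi> \<psi> = (if \<phi> = \<psi> then 1 else 0)"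
      by (auto simp: ell2_inner_complexify on inj_eq[OF inj_complexify])
    show "module.span fun_scale (complexify ` B) = ell2 G"
    proof (rule span_complexify)
      show "v \<in> E" if "lin_subspace E" "B \<subseteq> E" "\<forall>g. g \<notin> carrier G \<longrightarrow> v g = 0" for E v
        using B that unfolding eigenbasis_def by blast
    qed (rule supp)
  qed
  moreover have "cayley_eigenfunction G S \<phi>" if \<phi>: "\<phi> \<in> complexify ` B" for \<phi>
  proof -
    obtain v where v: "v \<in> B" "\<phi> = complexify v" using \<phi> by blast
    obtain c where c: "\<And>g. adj (carrier G) S v g = c * v g" using B v(1) unfolding eigenbasis_def by blast
    have "cayley_adjacency G S \<phi> = complexify (adj (carrier G) S v)"
      by (simp add: fun_eq_iff cayley_adjacency_def complexify_def adj_def v(2) mult)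
    also have "\<dots> = fun_scale (of_real c) \<phi>" by (simp add: fun_eq_iff complexify_def fun_scale_def v(2) c)
    finally have "cayley_adjacency G S \<phi> = fun_scale (of_real c) \<phi>" .
    moreover have "\<phi> \<noteq> 0"
    proof
      assume "\<phi> = 0"
      then have "v g = 0" for g using v(2) by (simp add: complexify_def fun_eq_iff)
      then have "ip (carrier G) v v = 0" by (simp add: ip_def)
      then show False using on[OF v(1) v(1)] by simp
    qed
    moreover have "\<phi> \<in> ell2 G" using supp[OF v(1)] by (simp add: v(2) ell2_def complexify_def)
    ultimately show ?thesis unfolding cayley_eigenfunction_def by blast
  qed
  moreover have "\<phi> g \<in> \<real>" if "\<phi> \<in> complexify ` B" for \<phi> g
    using that by (auto simp: complexify_def)
  moreover have "\<exists>d>0. n div 4 \<le> d \<and> (\<forall>i\<in>{1..M}.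
       \<bar>mass G \<phi> (f i) - (\<Sum>g\<in>carrier G. f i g) / real (order G)\<bar>
         \<le> 16 * max 1 (ln (real M * real d)) / sqrt d *
           (ell2_norm G (\<lambda>g. complex_of_real (f i g)) / sqrt (real (order G))))"
    if \<phi>: "\<phi> \<in> complexify ` B" for \<phi>
  proof -
    obtain v where v: "v \<in> B" "\<phi> = complexify v" using \<phi> by blast
    obtain d where d: "d > 0" "n div 4 \<le> d" and b: "\<And>i. i < M \<Longrightarrow>
      \<bar>mass G \<phi> (f (Suc i)) - (\<Sum>g\<in>carrier G. f (Suc i) g) / real (order G)\<bar>
         \<le> 16 * max 1 (ln (real M * real d)) / sqrt d *
           (ell2_norm G (\<lambda>g. complex_of_real (f (Suc i) g)) / sqrt (real (order G)))"
      using bd[OF v(1)] unfolding v(2) mass_complexify ell2_norm_of_real order_def card_atLeastAtMost diff_Suc_1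
      by blast
    have "\<bar>mass G \<phi> (f i) - (\<Sum>g\<in>carrier G. f i g) / real (order G)\<bar>
         \<le> 16 * max 1 (ln (real M * real d)) / sqrt d *
           (ell2_norm G (\<lambda>g. complex_of_real (f i g)) / sqrt (real (order G)))" if "i \<in> {1..M}" for i
    proof -
      have "i - 1 < M" "Suc (i - 1) = i" using that by auto
      then show ?thesis using b[of "i - 1"] by simp
    qed
    with d show ?thesis by blast
  qed
  ultimately show ?thesis by (intro exI[of _ "complexify ` B"]) blast
qed

theorem proposition1p7:
  fixes G :: "nat \<Rightarrow> (nat \<Rightarrow> nat) monoid"
    and S :: "nat \<Rightarrow> (nat \<Rightarrow> nat) set"
    and M :: "nat \<Rightarrow> nat"
    and f :: "nat \<Rightarrow> nat \<Rightarrow> (nat \<Rightarrow> nat) \<Rightarrow> real"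
  assumes "(\<forall>n. G n = alt_group n) \<or> (\<forall>n. G n = sym_group n)"
    and "\<And>n. S n \<subseteq> carrier (G n)"
    and "\<And>n. set_inv\<^bsub>G n\<^esub> (S n) = S n"
    and "(\<lambda>n. real (M n)) \<in> o(\<lambda>n. real n)"
  shows "\<exists>B :: nat \<Rightarrow> ((nat \<Rightarrow> nat) \<Rightarrow> complex) set.
    (\<forall>n. orthonormal_basis (G n) (B n) \<and>
         (\<forall>\<phi>\<in>B n. cayley_eigenfunction (G n) (S n) \<phi> \<and> (\<forall>g\<in>carrier (G n). \<phi> g \<in> \<real>))) \<and>
    (\<forall>\<^sub>F n in sequentially. \<forall>\<phi>\<in>B n. \<forall>i\<in>{1..M n}.
       \<bar>mass (G n) \<phi> (f n i) - (\<Sum>g\<in>carrier (G n). f n i g) / real (order (G n))\<bar>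
         \<le> 192 * (ln (real n) / sqrt (real n)) *
           (ell2_norm (G n) (\<lambda>g. complex_of_real (f n i g)) / sqrt (real (order (G n)))))"
proof -
  have G: "G n = alt_group n \<or> G n = sym_group n" for n using assms(1) by blast
  have "\<forall>n. \<exists>Bn. orthonormal_basis (G n) Bn \<and>
    (\<forall>\<phi>\<in>Bn. cayley_eigenfunction (G n) (S n) \<phi> \<and> (\<forall>g\<in>carrier (G n). \<phi> g \<in> \<real>)) \<and>
    (\<forall>\<phi>\<in>Bn. \<exists>d>0. n div 4 \<le> d \<and> (\<forall>i\<in>{1..M n}.
       \<bar>mass (G n) \<phi> (f n i) - (\<Sum>g\<in>carrier (G n). f n i g) / real (order (G n))\<bar>
         \<le> 16 * max 1 (ln (real (M n) * real d)) / sqrt d *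
           (ell2_norm (G n) (\<lambda>g. complex_of_real (f n i g)) / sqrt (real (order (G n))))))"
    by (rule allI, rule alt_or_sym_balanced_eigenbasis[OF G assms(2,3)])
  from choice[OF this] obtain B where B: "\<And>n. orthonormal_basis (G n) (B n)"
      "\<And>n. \<forall>\<phi>\<in>B n. cayley_eigenfunction (G n) (S n) \<phi> \<and> (\<forall>g\<in>carrier (G n). \<phi> g \<in> \<real>)"
    and bound: "\<And>n. \<forall>\<phi>\<in>B n. \<exists>d>0. n div 4 \<le> d \<and> (\<forall>i\<in>{1..M n}.
       \<bar>mass (G n) \<phi> (f n i) - (\<Sum>g\<in>carrier (G n). f n i g) / real (order (G n))\<bar>
         \<le> 16 * max 1 (ln (real (M n) * real d)) / sqrt d *
           (ell2_norm (G n) (\<lambda>g. complex_of_real (f n i g)) / sqrt (real (order (G n)))))"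
    by (elim exE) (rule that, blast+)
  \<comment> \<open>The constant \<open>1 / 5\<close> matches \<open>n \<le> 5 * d\<close>, so that
    \<open>M n \<le> d\<close> and the logarithm of \<open>M n * d\<close> is at most
    \<open>2 * ln d\<close>.\<close>
  have "\<forall>\<^sub>F n in sequentially. norm (real (M n)) \<le> 1 / 5 * norm (real n)"
    using landau_o.smallD[OF assms(4), of "1 / 5"] by simp
  then have "\<forall>\<^sub>F n in sequentially. \<forall>\<phi>\<in>B n. \<forall>i\<in>{1..M n}.
       \<bar>mass (G n) \<phi> (f n i) - (\<Sum>g\<in>carrier (G n). f n i g) / real (order (G n))\<bar>
         \<le> 192 * (ln (real n) / sqrt (real n)) *
           (ell2_norm (G n) (\<lambda>g. complex_of_real (f n i g)) / sqrt (real (order (G n))))"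
    using eventually_ge_at_top[of 20]
  proof eventually_elim
    case (elim n)
    show ?case
    proof (intro ballI)
      fix \<phi> i assume \<phi>: "\<phi> \<in> B n" and i: "i \<in> {1..M n}"
      obtain d where d: "n div 4 \<le> d" and b:
       "\<bar>mass (G n) \<phi> (f n i) - (\<Sum>g\<in>carrier (G n). f n i g) / real (order (G n))\<bar>
         \<le> 16 * max 1 (ln (real (M n) * real d)) / sqrt d *
           (ell2_norm (G n) (\<lambda>g. complex_of_real (f n i g)) / sqrt (real (order (G n))))"
        using bspec[OF bound \<phi>] i by blast
      \<comment> \<open>The index \<open>i\<close> in \<open>{1..M n}\<close> supplies
        \<open>1 \<le> M n\<close>, so that \<open>ln (M n * d)\<close> splits into a sum.\<close>
      have "16 * max 1 (ln (real (M n) * real d)) / sqrt d \<le> 192 * (ln (real n) / sqrt (real n))"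
        using elim d i by (intro log_sqrt_bound) auto
      moreover have "0 \<le> ell2_norm (G n) (\<lambda>g. complex_of_real (f n i g)) / sqrt (real (order (G n)))"
        by (simp add: ell2_norm_of_real sum_nonneg)
      ultimately show "\<bar>mass (G n) \<phi> (f n i) - (\<Sum>g\<in>carrier (G n). f n i g) / real (order (G n))\<bar>
         \<le> 192 * (ln (real n) / sqrt (real n)) *
           (ell2_norm (G n) (\<lambda>g. complex_of_real (f n i g)) / sqrt (real (order (G n))))"
        using b mult_right_mono by (meson order_trans)
    qed
  qed
  then show ?thesis using B by (intro exI[of _ B]) blast
qed

end
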